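(* Let $H_1$ and $H_2$ be Hilbert spaces, and let $S\in L(H_1,H_2)$ and $T\in L(H_2,H_1)$ be such that $R(TS)$ and $R(ST)$ are finite dimensional subspaces of $H_1$ and $H_2$ respectively. Let $H=H_1\oplus H_2$ be the orthogonal direct sum, let $U\in L(H)$ be the operator $U=\begin{pmatrix}0&T\\ S&0\end{pmatrix}$, i.e. $U(x_1,x_2)=(Tx_2,Sx_1)$, and let $V=U+U^*\in L(H)$. Then the following statements are equivalent: (i) $(S,T)$ is a Fredholm pair; (ii) $V=U+U^*$ is a Fredholm operator; (iii) $V^2$ is a Fredholm operator; (iv) $UU^*+U^*U$ is a Fredholm operator; (v) $TT^*+S^*S\in L(H_1)$ and $SS^*+T^*T\in L(H_2)$ are Fredholm operators.
   Context: For Hilbert spaces $H_1,H_2$, $L(H_1,H_2)$ denotes the bounded linear maps from $H_1$ to $H_2$, and $L(H)=L(H,H)$. $N(\cdot)$ and $R(\cdot)$ denote null space and range, and $*$ the Hilbert space adjoint. A pair $(S,T)$ with $S\in L(H_1,H_2)$, $T\in L(H_2,H_1)$ is called a Fredholm pair if the following dimensions are all finite: $a=\dim N(S)/(N(S)\cap R(T))$, $b=\dim R(T)/(N(S)\cap R(T))$, $c=\dim N(T)/(N(T)\cap R(S))$, $d=\dim R(S)/(N(T)\cap R(S))$. *)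

theory Defs
  imports "HOL-Analysis.Analysis"
begin

text \<open>
  The ground field may be the reals or the complex numbers: the axioms below are satisfied by
  real and complex (with their usual conjugations), and they force every element to be a sum of a
  real scalar and an element whose square is a nonpositive real scalar, so up to isomorphism there
  are no other instances.
\<close>

class real_or_complex = real_normed_field +
  fixes kcnj :: "'a \<Rightarrow> 'a"
  assumes kcnj_add: "kcnj (x + y) = kcnj x + kcnj y"
    and kcnj_mult: "kcnj (x * y) = kcnj x * kcnj y"
    and kcnj_kcnj: "kcnj (kcnj x) = x"
    and mult_kcnj: "x * kcnj x = (norm x)\<^sup>2 *\<^sub>R 1"

instantiation real :: real_or_complex
begin
definition kcnj_real :: "real \<Rightarrow> real" where "kcnj_real x = x"
instance by standard (simp_all add: kcnj_real_def power2_eq_square)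
end

instantiation complex :: real_or_complex
begin
definition kcnj_complex :: "complex \<Rightarrow> complex" where "kcnj_complex = cnj"
instance
proof
  fix x :: complex
  show "x * kcnj x = (norm x)\<^sup>2 *\<^sub>R 1"
    by (metis complex_norm_square kcnj_complex_def scaleR_conv_of_real mult_1_right)
qed (simp_all add: kcnj_complex_def)
end

text \<open>
  A Hilbert space over the ground field, whose inner product is linear in the first argument.
  Norm, topology and completeness are those of the type.  The sort \<^class>\<open>real_inner\<close> is no
  restriction: the norm determines the real inner product \<^const>\<open>inner\<close> of the type, which is the
  real part of \<open>ip\<close>.
\<close>

locale hilbert_space = vector_space scale
  for scale :: "'k::real_or_complex \<Rightarrow> 'a::{real_inner, complete_space} \<Rightarrow> 'a" +
  fixes ip :: "'a \<Rightarrow> 'a \<Rightarrow> 'k"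
  assumes scale_of_real: "scale (of_real r) x = r *\<^sub>R x"
    and ip_add_left: "ip (x + y) z = ip x z + ip y z"
    and ip_scale_left: "ip (scale c x) y = c * ip x y"
    and ip_commute: "ip y x = kcnj (ip x y)"
    and ip_self: "ip x x = of_real ((norm x)\<^sup>2)"

lemma hilbert_space_real:
  "hilbert_space ((*\<^sub>R) :: real \<Rightarrow> 'a::{real_inner, complete_space} \<Rightarrow> 'a) inner"
  by unfold_locales
    (simp_all add: kcnj_real_def algebra_simps inner_commute dot_square_norm)

lemma hilbert_space_complex:
  "hilbert_space ((*) :: complex \<Rightarrow> complex \<Rightarrow> complex) (\<lambda>x y. x * cnj y)"
proof unfold_locales
  fix x :: complex
  show "x * cnj x = of_real ((norm x)\<^sup>2)"
    using complex_norm_square by simp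
qed (simp_all add: kcnj_complex_def algebra_simps scaleR_conv_of_real)

text \<open>
  The orthogonal direct sum of two Hilbert spaces lives on the product type, whose norm is
  the Hilbert sum norm.
\<close>

abbreviation sum_scale ::
  "('k::real_or_complex \<Rightarrow> 'a::ab_group_add \<Rightarrow> 'a) \<Rightarrow> ('k \<Rightarrow> 'b::ab_group_add \<Rightarrow> 'b) \<Rightarrow> 'k \<Rightarrow> 'a \<times> 'b \<Rightarrow> 'a \<times> 'b"
  where "sum_scale s1 s2 \<equiv> module_prod.scale s1 s2"

definition sum_ip :: "('a \<Rightarrow> 'a \<Rightarrow> 'k::plus) \<Rightarrow> ('b \<Rightarrow> 'b \<Rightarrow> 'k) \<Rightarrow> 'a \<times> 'b \<Rightarrow> 'a \<times> 'b \<Rightarrow> 'k"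
  where "sum_ip ip1 ip2 x y = ip1 (fst x) (fst y) + ip2 (snd x) (snd y)"

lemma hilbert_space_sum:
  assumes "hilbert_space s1 ip1" "hilbert_space s2 ip2"
  shows "hilbert_space (sum_scale s1 s2) (sum_ip ip1 ip2)"
proof -
  interpret h1: hilbert_space s1 ip1 by fact
  interpret h2: hilbert_space s2 ip2 by fact
  interpret vector_space_prod s1 s2 ..
  show ?thesis
    by unfold_locales
      (auto simp: sum_ip_def scale_def scaleR_prod_def h1.scale_of_real h2.scale_of_real
        h1.ip_add_left h2.ip_add_left h1.ip_scale_left h2.ip_scale_left
        h1.ip_self h2.ip_self kcnj_add norm_prod_def algebra_simps
        h1.ip_commute[symmetric] h2.ip_commute[symmetric])
qed

definition bounded_op ::
  "('k::real_or_complex \<Rightarrow> 'a::real_normed_vector \<Rightarrow> 'a) \<Rightarrow> ('k \<Rightarrow> 'b::real_normed_vector \<Rightarrow> 'b) \<Rightarrow> ('a \<Rightarrow> 'b) \<Rightarrow> bool"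
  where "bounded_op s1 s2 f \<longleftrightarrow>
    Vector_Spaces.linear s1 s2 f \<and> (\<exists>K. \<forall>x. norm (f x) \<le> norm x * K)"

text \<open>Compare \<^const>\<open>adjoint\<close>, which is the case of the real scalars.\<close>

definition hilbert_adjoint ::
  "('a \<Rightarrow> 'a \<Rightarrow> 'k) \<Rightarrow> ('b \<Rightarrow> 'b \<Rightarrow> 'k) \<Rightarrow> ('a \<Rightarrow> 'b) \<Rightarrow> 'b \<Rightarrow> 'a"
  where "hilbert_adjoint ip1 ip2 f = (SOME g. \<forall>x y. ip2 (f x) y = ip1 x (g y))"

definition null_space :: "('a \<Rightarrow> 'b::zero) \<Rightarrow> 'a set"
  where "null_space f = {x. f x = 0}"

definition finite_dim :: "('k::field \<Rightarrow> 'a::ab_group_add \<Rightarrow> 'a) \<Rightarrow> 'a set \<Rightarrow> bool"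
  where "finite_dim s V \<longleftrightarrow> (\<exists>B. finite B \<and> module.span s B = V)"

text \<open>The set of cosets v + W with v in V; for a subspace W of V this is the quotient V / W.\<close>

definition cosets :: "'a::plus set \<Rightarrow> 'a set \<Rightarrow> 'a set set"
  where "cosets V W = (\<lambda>v. (+) v ` W) ` V"

text \<open>
  The dimension of V / W, for subspaces W \<open>\<subseteq>\<close> V, as the least number of vectors of V whose cosets
  span V / W.  The span of those cosets is the image of the span of the vectors.  The value is
  infinite (the infimum of the empty set) if there is no finite spanning set.
\<close>

definition quotient_dim :: "('k::field \<Rightarrow> 'a::ab_group_add \<Rightarrow> 'a) \<Rightarrow> 'a set \<Rightarrow> 'a set \<Rightarrow> enat"
  where "quotient_dim s V W =
    (INF B \<in> {B. finite B \<and> B \<subseteq> V \<and> cosets (module.span s B) W = cosets V W}. enat (card B))"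

definition fredholm_pair ::
  "('k::real_or_complex \<Rightarrow> 'a::real_normed_vector \<Rightarrow> 'a) \<Rightarrow> ('k \<Rightarrow> 'b::real_normed_vector \<Rightarrow> 'b) \<Rightarrow>
    ('a \<Rightarrow> 'b) \<Rightarrow> ('b \<Rightarrow> 'a) \<Rightarrow> bool"
  where "fredholm_pair s1 s2 S T \<longleftrightarrow>
    bounded_op s1 s2 S \<and> bounded_op s2 s1 T \<and>
    quotient_dim s1 (null_space S) (null_space S \<inter> range T) < \<infinity> \<and>
    quotient_dim s1 (range T) (null_space S \<inter> range T) < \<infinity> \<and>
    quotient_dim s2 (null_space T) (null_space T \<inter> range S) < \<infinity> \<and>
    quotient_dim s2 (range S) (null_space T \<inter> range S) < \<infinity>"

text \<open>Closedness of the range is not demanded, as it follows from finite codimension.\<close>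

definition fredholm_op :: "('k::real_or_complex \<Rightarrow> 'a::real_normed_vector \<Rightarrow> 'a) \<Rightarrow> ('a \<Rightarrow> 'a) \<Rightarrow> bool"
  where "fredholm_op s f \<longleftrightarrow>
    bounded_op s s f \<and> finite_dim s (null_space f) \<and> quotient_dim s UNIV (range f) < \<infinity>"

end

theory Submission
  imports Defs
begin

text \<open>
  Write \<open>N\<close> and \<open>R\<close> for null space and range, and read ``\<open>A\<close> is finite over \<open>B\<close>'' as: \<open>A\<close> is contained
  in the span of \<open>B\<close> and finitely many further vectors.  This relation is transitive and respects
  images and preimages under linear maps, so most of the theorem becomes a computation with it.
  Since \<open>R(U\<^sup>2) = R(TS) \<times> R(ST)\<close> is finite dimensional, \<open>R(U)\<close> is finite over \<open>N(U)\<close>, which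
  settles two of the four dimensions in the definition of a Fredholm pair; the other two are finite
  iff \<open>N(U) = N(S) \<times> N(T)\<close> is finite over \<open>R(U) = R(T) \<times> R(S)\<close>.  The operators \<open>V\<close>, \<open>V\<^sup>2\<close>
  and \<open>UU* + U*U\<close> are self-adjoint, so for them Fredholm means that the whole space is finite over
  the range; the null space, being orthogonal to the range, is then finite dimensional
  (\<open>self_adjoint_fredholm_iff\<close>).

  If \<open>R(V)\<close> has finite codimension, so has \<open>R(U) + R(U*)\<close>.  A vector of \<open>N(U)\<close> is then a sum of a
  vector of \<open>R(U)\<close>, a vector \<open>b\<close> of \<open>R(U*)\<close> and a vector of a fixed finite-dimensional space.  Applying
  \<open>U\<close> shows that \<open>U b\<close> lies in a finite-dimensional space; as \<open>U\<close> is injective on \<open>R(U*)\<close>, so does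
  \<open>b\<close>.  Hence \<open>N(U)\<close> is finite over \<open>R(U)\<close>.

  Completeness enters through the existence of adjoints and through the converse.  Suppose that the closed subspace \<open>N(U)\<close>
  is finite over \<open>R(U)\<close>.  The uniform boundedness principle makes
  \<open>\<parallel>U* y\<parallel>\<^sup>2 + \<Sum> \<bar>\<langle>y, e\<rangle>\<bar>\<^sup>2\<close>, with finitely many \<open>e\<close>, coercive on \<open>N(U)\<close>, and solving the corresponding
  variational problem shows that \<open>N(U)\<close> is even finite over \<open>R(UU*)\<close>
  (\<open>finite_over_range_comp_adjoint\<close>).  This replaces the theorem that a range of finite codimension
  is closed.  From here, \<open>R(U)\<close> is finite over \<open>R(UU*)\<close>, so the space is finite over
  \<open>N(U) + R(U*)\<close>, and applying \<open>U*\<close> shows that \<open>R(U*)\<close> is finite over \<open>U*(N(U))\<close>.  Now \<open>V\<close> agrees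
  with \<open>U*\<close> on \<open>N(U)\<close> and, up to an operator of finite rank, with \<open>U\<close> on \<open>R(U*)\<close>.  So \<open>U*(N(U))\<close> and
  \<open>R(UU*)\<close>, and with them \<open>R(U*)\<close>, \<open>N(U)\<close> and the whole space, are finite over \<open>R(V)\<close>.

  The remaining equivalences are formal: \<open>V\<close> and \<open>V\<^sup>2\<close> are Fredholm together,
  \<open>V\<^sup>2 = (UU* + U*U) + U\<^sup>2 + (U*)\<^sup>2\<close> differs from \<open>UU* + U*U\<close> by an operator of finite rank, and
  \<open>UU* + U*U\<close> is block diagonal with the two operators of (v) as its blocks.
\<close>

section \<open>Finite dimension modulo a set\<close>

text \<open>
  For subspaces \<open>W \<subseteq> V\<close> this says that \<open>V / W\<close> is finite dimensional
  (\<open>quotient_dim_finite_iff\<close>).  Arbitrary sets are allowed in order to have a preorder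
  that can be chained through sets such as \<open>R(U) \<union> R(U*)\<close>.
\<close>

definition finite_over :: "('k::field \<Rightarrow> 'a::ab_group_add \<Rightarrow> 'a) \<Rightarrow> 'a set \<Rightarrow> 'a set \<Rightarrow> bool"
  where "finite_over s A B \<longleftrightarrow> (\<exists>F. finite F \<and> A \<subseteq> module.span s (B \<union> F))"

context vector_space
begin

lemma finite_over_subset: "A \<subseteq> span B \<Longrightarrow> finite_over scale A B"
  unfolding finite_over_def by (intro exI[of _ "{}"]) simp

lemma finite_over_trans:
  assumes "finite_over scale A B" "finite_over scale B C"
  shows "finite_over scale A C"
proof -
  obtain F G where F: "finite F" "A \<subseteq> span (B \<union> F)" and G: "finite G" "B \<subseteq> span (C \<union> G)"
    using assms unfolding finite_over_def by blast
  have "B \<union> F \<subseteq> span (C \<union> (G \<union> F))"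
    using G(2) span_mono[of "C \<union> G" "C \<union> (G \<union> F)"] span_superset[of "C \<union> (G \<union> F)"] by blast
  then have "A \<subseteq> span (C \<union> (G \<union> F))"
    using F(2) span_minimal subspace_span by blast
  then show ?thesis
    unfolding finite_over_def using F(1) G(1) by blast
qed

lemma finite_over_mono:
  "finite_over scale A B \<Longrightarrow> A' \<subseteq> A \<Longrightarrow> B \<subseteq> span B' \<Longrightarrow> finite_over scale A' B'"
  by (meson finite_over_subset finite_over_trans span_superset subset_trans)

lemma finite_over_Un:
  assumes "finite_over scale A C" "finite_over scale B C"
  shows "finite_over scale (span (A \<union> B)) C"
proof -
  obtain F G where F: "finite F" "A \<subseteq> span (C \<union> F)" and G: "finite G" "B \<subseteq> span (C \<union> G)"
    using assms unfolding finite_over_def by blast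
  have "A \<union> B \<subseteq> span (C \<union> (F \<union> G))"
    using F(2) G(2) span_mono[of "C \<union> F" "C \<union> (F \<union> G)"] span_mono[of "C \<union> G" "C \<union> (F \<union> G)"]
    by blast
  then have "span (A \<union> B) \<subseteq> span (C \<union> (F \<union> G))"
    by (simp add: span_minimal)
  then show ?thesis
    unfolding finite_over_def using F(1) G(1) by blast
qed

lemma finite_over_empty_iff: "finite_over scale A {} \<longleftrightarrow> finite_over scale A {0}"
  by (metis finite_over_mono order_refl span_empty span_superset empty_subsetI)

text \<open>
  The modular law for subspaces, in the form that the finitely many extra vectors can be taken from
  \<open>A\<close> itself.  They are exchanged one at a time, because \<open>A \<inter> span (insert g B)\<close> exceeds \<open>A \<inter> B\<close> by
  at most one dimension.
\<close>

lemma finite_over_modular: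
  assumes A: "subspace A" and B: "subspace B" and "finite_over scale A B"
  obtains F where "finite F" "F \<subseteq> A" "A \<subseteq> span ((A \<inter> B) \<union> F)"
proof -
  obtain G where "finite G" "A \<subseteq> span (B \<union> G)"
    using assms(3) unfolding finite_over_def by blast
  then have "\<exists>F. finite F \<and> F \<subseteq> A \<and> A \<subseteq> span ((A \<inter> B) \<union> F)"
    using B
  proof (induction G arbitrary: B rule: finite_induct)
    case empty
    then have "A \<subseteq> A \<inter> B" by (simp add: span_eq_iff[THEN iffD2])
    then show ?case
      using span_superset by (intro exI[of _ "{}"]) fastforce
  next
    case (insert g G)
    let ?B = "span (insert g B)"
    have "B \<union> insert g G \<subseteq> span (?B \<union> G)"
      by (auto intro!: span_base)
    then have "A \<subseteq> span (?B \<union> G)"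
      using insert.prems(1) span_minimal subspace_span by blast
    from insert.IH[OF this subspace_span] obtain F where
      F: "finite F" "F \<subseteq> A" "A \<subseteq> span ((A \<inter> ?B) \<union> F)" by blast
    \<comment> \<open>a vector of \<open>A\<close> in \<open>span (insert g B)\<close> outside \<open>B\<close>, if there is one, generates \<open>A \<inter> span (insert g B)\<close> modulo \<open>A \<inter> B\<close>\<close>
    have "\<exists>a\<in>A. A \<inter> ?B \<subseteq> span (insert a (A \<inter> B))"
    proof (cases "A \<inter> ?B \<subseteq> B")
      case True
      then have "A \<inter> ?B \<subseteq> span (insert 0 (A \<inter> B))"
        by (auto intro: span_base)
      then show ?thesis using subspace_0[OF A] by blast
    next
      case False
      then obtain a where a: "a \<in> A" "a \<in> ?B" "a \<notin> B" by blast
      then obtain k where k: "a - scale k g \<in> B"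
        using insert.prems(2) by (auto simp: span_breakdown_eq span_eq_iff[THEN iffD2])
      have k0: "k \<noteq> 0" using k a(3) by auto
      have "x \<in> span (insert a (A \<inter> B))" if x: "x \<in> A" "x \<in> ?B" for x
      proof -
        obtain l where l: "x - scale l g \<in> B"
          using x(2) insert.prems(2) by (auto simp: span_breakdown_eq span_eq_iff[THEN iffD2])
        have "x - scale (l / k) a = (x - scale l g) - scale (l / k) (a - scale k g)"
          using k0 by (simp add: scale_right_diff_distrib)
        also have "\<dots> \<in> B"
          using subspace_diff[OF insert.prems(2) l subspace_scale[OF insert.prems(2) k]] .
        finally have "x - scale (l / k) a \<in> A \<inter> B"
          using x(1) a(1) A by (auto intro: subspace_diff subspace_scale)
        then show ?thesis
          unfolding span_breakdown_eq by (intro exI span_base)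
      qed
      then show ?thesis using a(1) by blast
    qed
    then obtain a where a: "a \<in> A" "A \<inter> ?B \<subseteq> span (insert a (A \<inter> B))" by blast
    have "(A \<inter> ?B) \<union> F \<subseteq> span ((A \<inter> B) \<union> insert a F)"
      using a(2) span_mono[of "insert a (A \<inter> B)" "(A \<inter> B) \<union> insert a F"]
      by (auto intro: span_base)
    then have "A \<subseteq> span ((A \<inter> B) \<union> insert a F)"
      using F(3) span_minimal subspace_span by blast
    then show ?case using F(1,2) a(1) by (intro exI[of _ "insert a F"]) auto
  qed
  then show ?thesis using that by blast
qed

lemma finite_over_Int:
  assumes "subspace A" "subspace B" "finite_over scale A B"
  shows "finite_over scale A (A \<inter> B)"
  using finite_over_modular[OF assms] unfolding finite_over_def by metis

lemma finite_dim_iff: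
  assumes "subspace A"
  shows "finite_dim scale A \<longleftrightarrow> finite_over scale A {0}"
proof
  assume "finite_dim scale A"
  then obtain B where "finite B" "span B = A" unfolding finite_dim_def by blast
  then have "finite_over scale A {}" unfolding finite_over_def by auto
  then show "finite_over scale A {0}" by (simp add: finite_over_empty_iff)
next
  assume "finite_over scale A {0}"
  then obtain F where F: "finite F" "F \<subseteq> A" "A \<subseteq> span ((A \<inter> {0}) \<union> F)"
    using finite_over_modular[OF assms subspace_single_0] by blast
  have "span ((A \<inter> {0}) \<union> F) \<subseteq> span F"
    by (rule span_minimal) (auto intro: span_base span_zero)
  then have "span F = A"
    using F assms by (metis order_antisym span_minimal subset_trans)
  then show "finite_dim scale A" unfolding finite_dim_def using F(1) by blast
qed

lemma quotient_dim_finite_iff: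
  assumes V: "subspace V" and W: "subspace W" and sub: "W \<subseteq> V"
  shows "quotient_dim scale V W < \<infinity> \<longleftrightarrow> finite_over scale V W"
proof -
  have "quotient_dim scale V W < \<infinity> \<longleftrightarrow>
    (\<exists>B. finite B \<and> B \<subseteq> V \<and> cosets (span B) W = cosets V W)"
    unfolding quotient_dim_def INF_less_iff by auto
  also have "\<dots> \<longleftrightarrow> finite_over scale V W"
  proof
    assume "\<exists>B. finite B \<and> B \<subseteq> V \<and> cosets (span B) W = cosets V W"
    then obtain B where B: "finite B" "B \<subseteq> V" "cosets (span B) W = cosets V W" by blast
    have "v \<in> span (W \<union> B)" if v: "v \<in> V" for v
    proof -
      have "(+) v ` W \<in> cosets (span B) W"
        unfolding B(3) using v by (simp add: cosets_def)
      then obtain b where b: "b \<in> span B" "(+) v ` W = (+) b ` W"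
        unfolding cosets_def by blast
      have "v + 0 \<in> (+) v ` W" using subspace_0[OF W] by blast
      then obtain w where "w \<in> W" "v = b + w" using b(2) by auto
      then show ?thesis
        using b(1) span_mono[of B "W \<union> B"] by (auto intro: span_add span_base)
    qed
    then show "finite_over scale V W" unfolding finite_over_def using B(1) by blast
  next
    assume "finite_over scale V W"
    then obtain F where F: "finite F" "F \<subseteq> V" "V \<subseteq> span ((V \<inter> W) \<union> F)"
      using finite_over_modular[OF V W] by blast
    have VW: "V \<inter> W = W" using sub by blast
    have sF: "span F \<subseteq> V" using F(2) V by (simp add: span_minimal)
    have "(+) v ` W \<in> (\<lambda>v. (+) v ` W) ` span F" if "v \<in> V" for v
    proof -
      have "span W = W" using W by simp
      moreover have "v \<in> span (W \<union> F)" using that F(3) VW by auto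
      ultimately have "v \<in> {w + f |w f. w \<in> W \<and> f \<in> span F}"
        by (simp only: span_Un)
      then obtain w f where wf: "w \<in> W" "f \<in> span F" "v = w + f"
        unfolding mem_Collect_eq by (elim exE conjE) (rule that)
      have "(+) v ` W = (+) f ` W"
      proof (intro equalityI subsetI)
        fix x assume "x \<in> (+) v ` W"
        then obtain u where u: "u \<in> W" "x = f + (w + u)" using wf by (auto simp: algebra_simps)
        show "x \<in> (+) f ` W"
          using u W wf(1) by (intro image_eqI[of x "(+) f" "w + u" W] subspace_add)
      next
        fix x assume "x \<in> (+) f ` W"
        then obtain u where u: "u \<in> W" "x = v + (u - w)" using wf by (auto simp: algebra_simps)
        show "x \<in> (+) v ` W"
          using u W wf(1) by (intro image_eqI[of x "(+) v" "u - w" W] subspace_diff)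
      qed
      then show ?thesis using wf(2) by blast
    qed
    then have "cosets (span F) W = cosets V W" unfolding cosets_def using sF by blast
    then show "\<exists>B. finite B \<and> B \<subseteq> V \<and> cosets (span B) W = cosets V W"
      using F(1,2) by blast
  qed
  finally show ?thesis .
qed

end

context Vector_Spaces.linear
begin

lemma finite_over_image:
  assumes "finite_over s1 A B"
  shows "finite_over s2 (f ` A) (f ` B)"
proof -
  obtain F where "finite F" "A \<subseteq> vs1.span (B \<union> F)"
    using assms unfolding finite_over_def by blast
  then have "f ` A \<subseteq> vs2.span (f ` B \<union> f ` F)"
    by (metis image_Un image_mono span_image)
  then show ?thesis unfolding finite_over_def using \<open>finite F\<close> by blast
qed

text \<open>
  The extra vectors that generate \<open>f ` A\<close> over \<open>B\<close> may be chosen in \<open>f ` A\<close>; preimages of them in \<open>A\<close>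
  generate \<open>A\<close> over \<open>A \<inter> f -` B\<close>.
\<close>

lemma finite_over_vimage:
  assumes A: "vs1.subspace A" and B: "vs2.subspace B" and "finite_over s2 (f ` A) B"
  shows "finite_over s1 A (A \<inter> f -` B)"
proof -
  have fA: "vs2.subspace (f ` A)" using A by (rule subspace_image)
  obtain F where F: "finite F" "F \<subseteq> f ` A" "f ` A \<subseteq> vs2.span ((f ` A \<inter> B) \<union> F)"
    using vs2.finite_over_modular[OF fA B assms(3)] by blast
  obtain G where G: "G \<subseteq> A" "finite G" "F = f ` G"
    using F(1,2) by (meson finite_subset_image)
  have "a \<in> vs1.span ((A \<inter> f -` B) \<union> G)" if a: "a \<in> A" for a
  proof -
    have "vs2.span (f ` A \<inter> B) = f ` A \<inter> B"
      using vs2.subspace_inter[OF fA B] by simp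
    moreover have "f a \<in> vs2.span ((f ` A \<inter> B) \<union> F)"
      using a F(3) by auto
    ultimately have "f a \<in> {b + h |b h. b \<in> f ` A \<inter> B \<and> h \<in> vs2.span F}"
      by (simp only: vs2.span_Un)
    then obtain b h where bh: "b \<in> f ` A \<inter> B" "h \<in> vs2.span F" "f a = b + h"
      unfolding mem_Collect_eq by (elim exE conjE) (rule that)
    obtain g where g: "g \<in> vs1.span G" "h = f g"
      using bh(2) unfolding G(3) span_image by blast
    have "g \<in> A" using g(1) G(1) A vs1.span_minimal by blast
    then have "a - g \<in> A \<inter> f -` B"
      using a A bh g(2) by (auto intro: vs1.subspace_diff simp: diff)
    then have "(a - g) + g \<in> vs1.span ((A \<inter> f -` B) \<union> G)"
      using g(1) vs1.span_mono[of G "(A \<inter> f -` B) \<union> G"]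
      by (intro vs1.span_add) (auto intro: vs1.span_base)
    then show ?thesis by simp
  qed
  then show ?thesis unfolding finite_over_def using G(2) by blast
qed

lemma subspace_range: "vs2.subspace (range f)"
  by (simp add: subspace_image)

lemma subspace_null_space: "vs1.subspace (null_space f)"
  by (simp add: null_space_def subspace_kernel)

lemma finite_over_Int_null_space:
  assumes sub: "vs1.subspace A" and "finite_over s2 (f ` A) {0}"
  shows "finite_over s1 A (A \<inter> null_space f)"
proof -
  have "A \<inter> f -` {0} = A \<inter> null_space f" by (auto simp: null_space_def)
  then show ?thesis
    using finite_over_vimage[OF sub vs2.subspace_single_0 assms(2)] by simp
qed

end

text \<open>
  If the space is finite over \<open>R(f)\<close>, applying \<open>f\<close> shows that \<open>R(f)\<close> is finite over \<open>R(f\<^sup>2)\<close>.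
\<close>

lemma finite_over_UNIV_square:
  assumes "Vector_Spaces.linear s s f"
  shows "finite_over s UNIV (range (f \<circ> f)) \<longleftrightarrow> finite_over s UNIV (range f)"
proof -
  interpret f: Vector_Spaces.linear s s f by fact
  show ?thesis
  proof
    assume "finite_over s UNIV (range (f \<circ> f))"
    then show "finite_over s UNIV (range f)"
      by (rule f.vs1.finite_over_mono) (auto intro: f.vs1.span_base)
  next
    assume R: "finite_over s UNIV (range f)"
    have "finite_over s (range f) (range (f \<circ> f))"
      using f.finite_over_image[OF R] by (simp add: image_comp)
    then show "finite_over s UNIV (range (f \<circ> f))" by (rule f.vs1.finite_over_trans[OF R])
  qed
qed

lemma finite_over_Times_iff:
  assumes "vector_space s1" "vector_space s2"
    and "0 \<in> A1" "0 \<in> A2" "0 \<in> B1" "0 \<in> B2"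
  shows "finite_over (sum_scale s1 s2) (A1 \<times> A2) (B1 \<times> B2) \<longleftrightarrow>
    finite_over s1 A1 B1 \<and> finite_over s2 A2 B2" (is "?P \<longleftrightarrow> ?Q")
proof -
  interpret v1: vector_space s1 by fact
  interpret v2: vector_space s2 by fact
  interpret p: vector_space_prod s1 s2 ..
  interpret fst: Vector_Spaces.linear "sum_scale s1 s2" s1 fst
    by unfold_locales (simp_all add: p.scale_def)
  interpret snd: Vector_Spaces.linear "sum_scale s1 s2" s2 snd
    by unfold_locales (simp_all add: p.scale_def)
  interpret inl: Vector_Spaces.linear s1 "sum_scale s1 s2" "\<lambda>x. (x, 0)"
    by unfold_locales (simp_all add: p.scale_def)
  interpret inr: Vector_Spaces.linear s2 "sum_scale s1 s2" "\<lambda>x. (0, x)"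
    by unfold_locales (simp_all add: p.scale_def)
  show ?thesis
  proof
    assume ?P
    have "A1 \<noteq> {}" "A2 \<noteq> {}" "B1 \<noteq> {}" "B2 \<noteq> {}" using assms by auto
    then show ?Q
      using fst.finite_over_image[OF \<open>?P\<close>] snd.finite_over_image[OF \<open>?P\<close>] by simp
  next
    assume ?Q
    then have "finite_over (sum_scale s1 s2) ((\<lambda>x. (x, 0)) ` A1) ((\<lambda>x. (x, 0)) ` B1)"
      "finite_over (sum_scale s1 s2) ((\<lambda>x. (0, x)) ` A2) ((\<lambda>x. (0, x)) ` B2)"
      using inl.finite_over_image inr.finite_over_image by blast+
    moreover have "(\<lambda>x. (x, 0)) ` B1 \<subseteq> p.p.span (B1 \<times> B2)"
      "(\<lambda>x. (0, x)) ` B2 \<subseteq> p.p.span (B1 \<times> B2)"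
      using assms(5,6) by (auto intro: p.p.span_base)
    ultimately have "finite_over (sum_scale s1 s2) ((\<lambda>x. (x, 0)) ` A1) (B1 \<times> B2)"
      "finite_over (sum_scale s1 s2) ((\<lambda>x. (0, x)) ` A2) (B1 \<times> B2)"
      by (meson p.p.finite_over_mono order_refl)+
    then have *: "finite_over (sum_scale s1 s2)
      (p.p.span ((\<lambda>x. (x, 0)) ` A1 \<union> (\<lambda>x. (0, x)) ` A2)) (B1 \<times> B2)"
      by (rule p.p.finite_over_Un)
    have "(a, b) \<in> p.p.span ((\<lambda>x. (x, 0)) ` A1 \<union> (\<lambda>x. (0, x)) ` A2)"
      if "a \<in> A1" "b \<in> A2" for a b
    proof -
      have "(a, 0) + (0, b) \<in> p.p.span ((\<lambda>x. (x, 0)) ` A1 \<union> (\<lambda>x. (0, x)) ` A2)"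
        using that by (intro p.p.span_add p.p.span_base) auto
      then show ?thesis by simp
    qed
    then have "A1 \<times> A2 \<subseteq> p.p.span ((\<lambda>x. (x, 0)) ` A1 \<union> (\<lambda>x. (0, x)) ` A2)"
      by blast
    then show ?P by (rule p.p.finite_over_mono[OF * _ p.p.span_superset])
  qed
qed


section \<open>Coercive forms and uniform boundedness\<close>

text \<open>
  Lax-Milgram for symmetric forms, proved by minimising \<open>\<langle>B y, y\<rangle> - 2 f(y)\<close> over \<open>N\<close>: coercivity and the
  parallelogram law make minimising sequences Cauchy.  With the identity for \<open>B\<close> it is the Riesz
  representation theorem (\<open>N = UNIV\<close>) and the existence of orthogonal projections
  (\<open>f = \<langle>x, _\<rangle>\<close>).
\<close>

lemma coercive_variational:
  fixes B :: "'a::{real_inner, complete_space} \<Rightarrow> 'a" and f :: "'a \<Rightarrow> real"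
  assumes B: "bounded_linear B" and sym: "\<And>x y. inner (B x) y = inner x (B y)"
    and f: "bounded_linear f"
    and N: "subspace N" "closed N"
    and c: "c > 0" and coercive: "\<And>y. y \<in> N \<Longrightarrow> c * (norm y)\<^sup>2 \<le> inner (B y) y"
  shows "\<exists>y\<in>N. \<forall>z\<in>N. inner (B y) z = f z"
proof -
  interpret B: bounded_linear B by fact
  interpret f: bounded_linear f by fact
  define J where "J y = inner (B y) y - 2 * f y" for y
  obtain K where K: "\<And>x. norm (f x) \<le> norm x * K" using f.bounded by blast
  have low: "- K\<^sup>2 / c \<le> J y" if "y \<in> N" for y
  proof -
    have "0 \<le> (c * norm y - K)\<^sup>2 / c" using c by simp
    also have "\<dots> = c * (norm y)\<^sup>2 - 2 * (norm y * K) + K\<^sup>2 / c"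
      using c by (simp add: power2_eq_square field_simps)
    also have "c * (norm y)\<^sup>2 - 2 * (norm y * K) \<le> J y"
      unfolding J_def using coercive[OF that] K[of y] by auto
    finally show ?thesis by simp
  qed
  define m where "m = Inf (J ` N)"
  have N0: "0 \<in> N" using N(1) subspace_0 by blast
  have bdd: "bdd_below (J ` N)" using low by (auto intro!: bdd_belowI2)
  have m: "m \<le> J y" if "y \<in> N" for y
    unfolding m_def using bdd that by (simp add: cINF_lower)
  have "\<exists>y\<in>N. J y < m + inverse (real (Suc n))" for n
  proof -
    have "Inf (J ` N) < m + inverse (real (Suc n))" unfolding m_def by simp
    then show ?thesis using N0 bdd by (subst (asm) cInf_less_iff) auto
  qed
  then obtain X where X: "\<And>n. X n \<in> N" "\<And>n. J (X n) < m + inverse (real (Suc n))" by metis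
  \<comment> \<open>the parallelogram law for the quadratic form of \<open>B\<close>\<close>
  have close: "c * (norm (a - b))\<^sup>2 \<le> 2 * (J a - m) + 2 * (J b - m)" if ab: "a \<in> N" "b \<in> N" for a b
  proof -
    have "(1/2) *\<^sub>R (a + b) \<in> N" using ab N(1) by (intro subspace_scale subspace_add)
    then have "m \<le> J ((1/2) *\<^sub>R (a + b))" by (rule m)
    moreover have "inner (B (a - b)) (a - b) = 2 * J a + 2 * J b - 4 * J ((1/2) *\<^sub>R (a + b))"
      unfolding J_def
      by (simp add: B.scaleR B.add B.diff f.scaleR f.add inner_add inner_diff algebra_simps)
    moreover have "c * (norm (a - b))\<^sup>2 \<le> inner (B (a - b)) (a - b)"
      using ab N(1) by (intro coercive subspace_diff)
    ultimately show ?thesis by simp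
  qed
  have "Cauchy X"
  proof (rule metric_CauchyI)
    fix e :: real assume e: "e > 0"
    obtain M where M: "inverse (real (Suc M)) < c * e\<^sup>2 / 4"
      using reals_Archimedean[of "c * e\<^sup>2 / 4"] c e by auto
    have "dist (X i) (X j) < e" if "i \<ge> M" "j \<ge> M" for i j
    proof -
      have *: "J (X i) - m < c * e\<^sup>2 / 4" if "i \<ge> M" for i
      proof -
        have "inverse (real (Suc i)) \<le> inverse (real (Suc M))" using that by simp
        then show ?thesis using X(2)[of i] M by linarith
      qed
      have "c * (norm (X i - X j))\<^sup>2 < c * e\<^sup>2"
        using close[OF X(1) X(1), of i j] *[OF that(1)] *[OF that(2)] by simp
      then show ?thesis using c e by (simp add: dist_norm power_less_imp_less_base)
    qed
    then show "\<exists>M. \<forall>i\<ge>M. \<forall>j\<ge>M. dist (X i) (X j) < e" by blast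
  qed
  then obtain y where y: "X \<longlonglongrightarrow> y" using Cauchy_convergent convergent_def by blast
  have yN: "y \<in> N" using closed_sequentially[OF N(2)] X(1) y by blast
  have "(\<lambda>n. J (X n)) \<longlonglongrightarrow> J y"
    unfolding J_def using y by (intro tendsto_intros B.tendsto f.tendsto)
  moreover have "(\<lambda>n. m + inverse (real (Suc n))) \<longlonglongrightarrow> m + 0"
    by (intro tendsto_intros LIMSEQ_inverse_real_of_nat)
  ultimately have Jy: "J y \<le> m"
    using X(2) by (intro LIMSEQ_le[of "\<lambda>n. J (X n)" _ "\<lambda>n. m + inverse (real (Suc n))"])
      (auto intro: less_imp_le)
  have "inner (B y) z = f z" if z: "z \<in> N" for z
  proof (rule ccontr)
    define p where "p = inner (B y) z - f z"
    define q where "q = inner (B z) z"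
    assume "inner (B y) z \<noteq> f z"
    then have p: "p \<noteq> 0" by (simp add: p_def)
    have q: "q \<ge> 0" using coercive[OF z] c unfolding q_def
      by (meson mult_nonneg_nonneg less_imp_le order_trans zero_le_power2)
    have ineq: "0 \<le> t\<^sup>2 * q + 2 * t * p" for t
    proof -
      have "y + t *\<^sub>R z \<in> N" using yN z N(1) by (intro subspace_scale subspace_add)
      then have "J y \<le> J (y + t *\<^sub>R z)" using m Jy by force
      moreover have "J (y + t *\<^sub>R z) = J y + (t\<^sup>2 * q + 2 * t * p)"
        unfolding J_def p_def q_def using sym[of z y]
        by (simp add: B.scaleR B.add f.scaleR f.add inner_add inner_commute algebra_simps
            power2_eq_square)
      ultimately show ?thesis by simp
    qed
    \<comment> \<open>the minimiser would be \<open>- p / q\<close>; adding 1 covers \<open>q = 0\<close>\<close>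
    define t where "t = - p / (q + 1)"
    have pt: "p = - t * (q + 1)" unfolding t_def using q by simp
    have "t\<^sup>2 * q + 2 * t * p = - (t\<^sup>2 * (q + 2))"
      unfolding pt by (simp add: algebra_simps power2_eq_square)
    also have "\<dots> < 0" using p q pt by simp
    finally show False using ineq[of t] by simp
  qed
  then show ?thesis using yN by blast
qed

text \<open>
  The uniform boundedness principle for the functionals \<open>\<langle>y, _\<rangle>\<close> on \<open>N\<close>, by the gliding hump argument
  of Sokal.  If \<open>y n\<close> has norm above \<open>4 ^ n\<close>, one builds a Cauchy sequence whose \<open>n\<close>-th step has length
  at most \<open>(1/3) ^ n\<close> and makes the product with \<open>y n\<close> at least \<open>(1/3) ^ n * norm (y n)\<close>; the later
  steps can undo only half of that.
\<close>

lemma weakly_bounded_imp_bounded: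
  fixes N Y :: "'a::{real_inner, complete_space} set"
  assumes N: "subspace N" "closed N" and Y: "Y \<subseteq> N"
    and weak: "\<And>z. z \<in> N \<Longrightarrow> \<exists>C. \<forall>y\<in>Y. \<bar>inner y z\<bar> \<le> C"
  obtains C where "\<And>y. y \<in> Y \<Longrightarrow> norm y \<le> C"
proof -
  have False if unb: "\<not> (\<exists>C. \<forall>y\<in>Y. norm y \<le> C)"
  proof -
    have "\<exists>y\<in>Y. norm y > 4 ^ n" for n :: nat using unb by (meson not_le)
    then obtain y where y: "\<And>n. y n \<in> Y" "\<And>n. norm (y n) > 4 ^ n" by metis
    \<comment> \<open>one of the points \<open>x + d\<close> and \<open>x - d\<close>, with \<open>d\<close> along \<open>y n\<close>, has a large product\<close>
    have step: "\<exists>x'. x' \<in> N \<and> dist x' x \<le> (1/3) ^ n \<and> \<bar>inner (y n) x'\<bar> \<ge> (1/3) ^ n * norm (y n)"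
      if x: "x \<in> N" for x n
    proof -
      define d where "d = ((1/3) ^ n / norm (y n)) *\<^sub>R y n"
      have "norm (y n) > 0" using y(2)[of n] by (meson less_trans zero_less_power zero_less_numeral)
      then have nd: "norm d = (1/3) ^ n" and id: "inner (y n) d = (1/3) ^ n * norm (y n)"
        by (simp_all add: d_def dot_square_norm power2_eq_square)
      have dN: "d \<in> N" unfolding d_def using N(1) Y y(1) by (blast intro: subspace_scale)
      have "\<bar>inner (y n) (x + d)\<bar> \<ge> (1/3) ^ n * norm (y n) \<or>
        \<bar>inner (y n) (x - d)\<bar> \<ge> (1/3) ^ n * norm (y n)"
        unfolding inner_add_right inner_diff_right id by linarith
      moreover have "x + d \<in> N" "x - d \<in> N"
        using x dN N(1) by (auto intro: subspace_add subspace_diff)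
      moreover have "dist (x + d) x \<le> (1/3) ^ n" "dist (x - d) x \<le> (1/3) ^ n"
        using nd by (simp_all add: dist_norm)
      ultimately show ?thesis by blast
    qed
    define x where "x = rec_nat 0 (\<lambda>n x. SOME x'. x' \<in> N \<and> dist x' x \<le> (1/3) ^ n \<and>
      \<bar>inner (y n) x'\<bar> \<ge> (1/3) ^ n * norm (y n))"
    have xS: "x (Suc n) = (SOME x'. x' \<in> N \<and> dist x' (x n) \<le> (1/3) ^ n \<and>
      \<bar>inner (y n) x'\<bar> \<ge> (1/3) ^ n * norm (y n))" for n
      by (simp add: x_def)
    have xN: "x n \<in> N" for n
    proof (induction n)
      case 0
      show ?case using N(1) by (simp add: x_def subspace_0)
    next
      case (Suc n)
      from someI_ex[OF step[OF Suc, of n]] show ?case by (simp add: xS)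
    qed
    have xd: "dist (x (Suc n)) (x n) \<le> (1/3) ^ n"
      and xi: "\<bar>inner (y n) (x (Suc n))\<bar> \<ge> (1/3) ^ n * norm (y n)" for n
      using someI_ex[OF step[OF xN, of n n]] by (simp_all add: xS)
    have tail: "dist (x (n + k)) (x n) \<le> (3/2) * (1/3) ^ n - (3/2) * (1/3) ^ (n + k)" for n k
    proof (induction k)
      case (Suc k)
      have "dist (x (n + Suc k)) (x n) \<le> dist (x (Suc (n + k))) (x (n + k)) + dist (x (n + k)) (x n)"
        using dist_triangle[of "x (Suc (n + k))" "x n" "x (n + k)"] by simp
      then show ?case using Suc xd[of "n + k"] by simp
    qed simp
    have tail': "dist (x (n + k)) (x n) \<le> (3/2) * (1/3) ^ n" for n k
    proof -
      have "0 \<le> (3/2) * (1/3 :: real) ^ (n + k)" by simp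
      then show ?thesis using tail[of n k] by linarith
    qed
    have "Cauchy x"
    proof (rule metric_CauchyI)
      fix e :: real assume e: "e > 0"
      obtain M where M: "(1/3) ^ M < e / 3"
        using real_arch_pow_inv[of "e / 3" "1/3"] e by auto
      have d: "dist (x i) (x M) < e / 2" if "i \<ge> M" for i
        using tail'[of M "i - M"] that M by simp
      show "\<exists>M. \<forall>i\<ge>M. \<forall>j\<ge>M. dist (x i) (x j) < e"
        using d by (meson dist_triangle_half_l dist_commute)
    qed
    then obtain z where z: "x \<longlonglongrightarrow> z" using Cauchy_convergent convergent_def by blast
    have zN: "z \<in> N" using closed_sequentially[OF N(2)] xN z by blast
    have zx: "dist z (x n) \<le> (3/2) * (1/3) ^ n" for n
    proof -
      have "(\<lambda>k. dist (x (k + n)) (x n)) \<longlonglongrightarrow> dist z (x n)"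
        using LIMSEQ_ignore_initial_segment[OF z, of n] by (intro tendsto_dist tendsto_const)
      then show ?thesis using tail'[of n] by (intro LIMSEQ_le_const2) (auto simp: add.commute)
    qed
    \<comment> \<open>the steps after step \<open>n\<close> undo at most half of the product with \<open>y n\<close>\<close>
    have big: "(4/3) ^ n / 2 \<le> \<bar>inner (y n) z\<bar>" for n
    proof -
      have "\<bar>inner (y n) (x (Suc n))\<bar> - \<bar>inner (y n) z\<bar> \<le> \<bar>inner (y n) (z - x (Suc n))\<bar>"
        by (simp add: inner_diff_right)
      also have "\<dots> \<le> norm (y n) * dist z (x (Suc n))"
        by (simp add: dist_norm Cauchy_Schwarz_ineq2)
      also have "\<dots> \<le> norm (y n) * ((1/3) ^ n / 2)"
        using zx[of "Suc n"] by (intro mult_left_mono) simp_all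
      finally have "norm (y n) * ((1/3) ^ n / 2) \<le> \<bar>inner (y n) z\<bar>"
        using xi[of n] by (simp add: algebra_simps)
      moreover have "4 ^ n * ((1/3) ^ n / 2) \<le> norm (y n) * ((1/3) ^ n / (2::real))"
        using y(2)[of n] by (intro mult_right_mono) simp_all
      moreover have "4 ^ n * ((1/3) ^ n / 2) = (4/3) ^ n / (2::real)"
        by (simp add: power_divide)
      ultimately show ?thesis by linarith
    qed
    obtain C where C: "\<And>y. y \<in> Y \<Longrightarrow> \<bar>inner y z\<bar> \<le> C" using weak[OF zN] by blast
    obtain n where "2 * C < (4/3) ^ n" using real_arch_pow[of "4/3" "2 * C"] by auto
    then show False using big[of n] C[OF y(1), of n] by simp
  qed
  then show thesis using that by blast
qed

section \<open>The inner product over the ground field and adjoints\<close>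

lemma kcnj_zero [simp]: "kcnj (0::'k::real_or_complex) = 0"
  using kcnj_add[of "0::'k" 0] by simp

lemma norm_kcnj [simp]: "norm (kcnj (x::'k::real_or_complex)) = norm x"
proof (cases "x = 0")
  case False
  have "norm x * norm (kcnj x) = (norm x)\<^sup>2"
    by (simp add: norm_mult[symmetric] mult_kcnj)
  then show ?thesis using False by (simp add: power2_eq_square)
qed simp

lemma kcnj_of_real [simp]: "kcnj (of_real r :: 'k::real_or_complex) = of_real r"
proof (cases "r = 0")
  case False
  have "of_real r * kcnj (of_real r :: 'k) = of_real r * of_real r"
    by (simp add: mult_kcnj power2_eq_square of_real_def)
  then show ?thesis using False by simp
qed simp

context hilbert_space
begin

lemma ip_add_right: "ip x (y + z) = ip x y + ip x z"
  by (metis ip_commute ip_add_left kcnj_add)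

lemma ip_scale_right: "ip x (scale c y) = kcnj c * ip x y"
  by (metis ip_commute ip_scale_left kcnj_mult kcnj_kcnj)

text \<open>
  The real inner product of the type is the real part of \<open>ip\<close>.  Orthogonality to a subspace over the
  ground field means the same for both, which allows the analysis to be done with \<open>inner\<close>.
\<close>

lemma ip_eq_real_part: "ip x y + ip y x = of_real (2 * inner x y)"
proof -
  have "of_real ((norm (x + y))\<^sup>2) = ip x x + ip y y + (ip x y + ip y x)"
    by (simp add: ip_self[symmetric] ip_add_left ip_add_right del: of_real_power)
  moreover have "(norm (x + y))\<^sup>2 = (norm x)\<^sup>2 + (norm y)\<^sup>2 + 2 * inner x y"
    by (simp add: power2_norm_eq_inner inner_add inner_commute)
  ultimately show ?thesis by (simp add: ip_self del: of_real_power)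
qed

lemma inner_of_ip:
  assumes "ip x y = of_real r"
  shows "inner x y = r"
proof -
  have "of_real (2 * inner x y) = (of_real (2 * r) :: 'k)"
    using ip_eq_real_part[of x y] ip_commute[of y x] assms by simp
  then show ?thesis by (simp only: of_real_eq_iff)
qed

lemma inner_scale_left: "inner (scale c x) y = inner x (scale (kcnj c) y)"
proof -
  have "(of_real (2 * inner (scale c x) y) :: 'k) = of_real (2 * inner x (scale (kcnj c) y))"
    unfolding ip_eq_real_part[symmetric] by (simp add: ip_scale_left ip_scale_right kcnj_kcnj)
  then show ?thesis by (simp only: of_real_eq_iff)
qed

lemma norm_scale: "norm (scale c x) = norm c * norm x"
proof -
  have "(of_real ((norm (scale c x))\<^sup>2) :: 'k) = (c * kcnj c) * ip x x"
    by (simp only: ip_self[symmetric] ip_scale_left ip_scale_right ac_simps)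
  also have "\<dots> = of_real ((norm c * norm x)\<^sup>2)"
    by (simp add: mult_kcnj ip_self of_real_def power_mult_distrib)
  finally have "(norm (scale c x))\<^sup>2 = (norm c * norm x)\<^sup>2" by (simp only: of_real_eq_iff)
  then show ?thesis by simp
qed

lemma norm_ip_le: "norm (ip x y) \<le> norm x * norm y"
proof (cases "ip x y = 0")
  case False
  have "ip (scale (kcnj (ip x y)) x) y = of_real ((norm (ip x y))\<^sup>2)"
    using mult_kcnj[of "ip x y"] by (simp add: ip_scale_left mult.commute of_real_def)
  then have "(norm (ip x y))\<^sup>2 = inner (scale (kcnj (ip x y)) x) y"
    by (rule inner_of_ip[symmetric])
  also have "\<dots> \<le> norm (ip x y) * norm x * norm y"
    using norm_cauchy_schwarz[of "scale (kcnj (ip x y)) x" y] by (simp add: norm_scale)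
  finally show ?thesis using False by (simp add: power2_eq_square mult.assoc)
qed simp

lemma abs_inner_le_norm_ip: "\<bar>inner x y\<bar> \<le> norm (ip x y)"
proof -
  have "2 * \<bar>inner x y\<bar> = norm (of_real (2 * inner x y) :: 'k)"
    by (simp only: norm_of_real)
  also have "\<dots> \<le> norm (ip x y) + norm (ip y x)"
    unfolding ip_eq_real_part[symmetric] by (rule norm_triangle_ineq)
  also have "\<dots> = 2 * norm (ip x y)" by (simp add: ip_commute[of y x])
  finally show ?thesis by simp
qed

lemma real_subspace: "subspace N \<Longrightarrow> Real_Vector_Spaces.subspace N"
  unfolding real_vector.subspace_def
  by (metis scale_of_real subspace_0 subspace_add subspace_scale)

lemma subspace_orthogonal:
  assumes "subspace N"
  shows "subspace {w. \<forall>z\<in>N. inner w z = 0}"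
  using subspace_scale[OF assms]
  by (auto intro!: subspaceI simp: inner_add_left inner_scale_left)

lemma orthogonal_projection:
  assumes "subspace N" "closed N"
  shows "\<exists>p\<in>N. \<forall>z\<in>N. inner (x - p) z = 0"
proof -
  have "\<exists>p\<in>N. \<forall>z\<in>N. inner p z = inner x z"
    by (rule coercive_variational[of "\<lambda>x. x" "inner x" N 1])
      (simp_all add: bounded_linear_ident bounded_linear_inner_right power2_norm_eq_inner
        real_subspace assms)
  then show ?thesis by (metis inner_diff_left diff_self)
qed

end

locale hilbert_space_pair =
  h1: hilbert_space s1 ip1 + h2: hilbert_space s2 ip2
  for s1 :: "'k::real_or_complex \<Rightarrow> 'a::{real_inner, complete_space} \<Rightarrow> 'a" and ip1
    and s2 :: "'k \<Rightarrow> 'b::{real_inner, complete_space} \<Rightarrow> 'b" and ip2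
begin

lemma bounded_op_bounded_linear:
  assumes "bounded_op s1 s2 f"
  shows "bounded_linear f"
proof -
  interpret Vector_Spaces.linear s1 s2 f using assms by (simp add: bounded_op_def)
  show ?thesis
    using assms unfolding bounded_op_def
    by (auto intro!: bounded_linear_intro simp: add h1.scale_of_real[symmetric]
        h2.scale_of_real[symmetric] scale)
qed

text \<open>
  An identity of real parts that persists under multiplication by scalars is an identity: for the
  difference \<open>d\<close> of the two sides, take the scalar \<open>kcnj d\<close>.
\<close>

lemma ip_eqI:
  assumes "\<And>c. inner (s2 c a) b = inner (s1 c x) y"
  shows "ip2 a b = ip1 x y"
proof -
  define d where "d = ip2 a b - ip1 x y"
  have *: "c * ip2 a b + kcnj (c * ip2 a b) = c * ip1 x y + kcnj (c * ip1 x y)" for c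
    using assms[of c] h2.ip_eq_real_part[of "s2 c a" b] h1.ip_eq_real_part[of "s1 c x" y]
    by (simp add: h1.ip_commute[of y "s1 c x"] h2.ip_commute[of b "s2 c a"]
        h1.ip_commute[of "s1 c x" y] h2.ip_commute[of "s2 c a" b]
        h1.ip_scale_left h2.ip_scale_left)
  have "kcnj d * d + kcnj (kcnj d * d) = 0"
  proof -
    have "kcnj (kcnj d * ip2 a b) = kcnj (kcnj d * d) + kcnj (kcnj d * ip1 x y)"
      unfolding kcnj_add[symmetric] by (simp add: d_def algebra_simps)
    then show ?thesis using *[of "kcnj d"] by (simp add: d_def algebra_simps)
  qed
  moreover have "kcnj d * d = of_real ((norm d)\<^sup>2)"
    using mult_kcnj[of d] by (simp add: mult.commute of_real_def)
  ultimately have "of_real ((norm d)\<^sup>2 + (norm d)\<^sup>2) = (0::'k)"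
    by (simp only: kcnj_of_real of_real_add)
  then have "(norm d)\<^sup>2 + (norm d)\<^sup>2 = 0" by (simp only: of_real_eq_0_iff)
  then have "d = 0" by simp
  then show ?thesis by (simp add: d_def)
qed

lemma inner_eq_of_ip_eq:
  assumes "ip2 a b = ip1 x y"
  shows "inner a b = inner x y"
proof -
  have "(of_real (2 * inner a b) :: 'k) = of_real (2 * inner x y)"
    unfolding h1.ip_eq_real_part[symmetric] h2.ip_eq_real_part[symmetric]
    using assms by (simp add: h1.ip_commute[of y x] h2.ip_commute[of b a])
  then show ?thesis by (simp only: of_real_eq_iff)
qed

text \<open>
  Riesz representation for the real inner product, transferred to \<open>ip\<close> by \<open>ip_eqI\<close>.
\<close>

lemma hilbert_adjoint_ip:
  assumes "bounded_op s1 s2 f"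
  shows "ip2 (f x) y = ip1 x (hilbert_adjoint ip1 ip2 f y)"
proof -
  interpret f: Vector_Spaces.linear s1 s2 f using assms by (simp add: bounded_op_def)
  have bl: "bounded_linear f" by (rule bounded_op_bounded_linear[OF assms])
  have "\<exists>g. \<forall>x. inner g x = inner (f x) y" for y
  proof -
    have "\<exists>g\<in>UNIV. \<forall>x\<in>UNIV. inner g x = inner (f x) y"
      by (rule coercive_variational[of "\<lambda>x. x" "\<lambda>x. inner (f x) y" UNIV 1])
        (simp_all add: bounded_linear_ident bounded_linear_inner_left_comp[OF bl]
          power2_norm_eq_inner)
    then show ?thesis by blast
  qed
  then obtain g where g: "\<And>x y. inner (g y) x = inner (f x) y" by metis
  have "ip2 (f x) y = ip1 x (g y)" for x y
  proof (rule ip_eqI)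
    fix c
    have "inner (s2 c (f x)) y = inner (g y) (s1 c x)"
      by (simp only: g f.scale)
    then show "inner (s2 c (f x)) y = inner (s1 c x) (g y)"
      using inner_commute[of "g y" "s1 c x"] by simp
  qed
  then have "\<exists>g. \<forall>x y. ip2 (f x) y = ip1 x (g y)" by blast
  then show ?thesis unfolding hilbert_adjoint_def by (rule someI2_ex) blast
qed

lemma hilbert_adjoint_eqI:
  assumes "bounded_op s1 s2 f" "\<And>x y. ip2 (f x) y = ip1 x (g y)"
  shows "hilbert_adjoint ip1 ip2 f = g"
proof
  fix y
  let ?u = "hilbert_adjoint ip1 ip2 f y"
  have "inner x ?u = inner x (g y)" for x
    using assms(2)[of x y] hilbert_adjoint_ip[OF assms(1), of x y]
    by (metis inner_eq_of_ip_eq)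
  then show "?u = g y" by (metis vector_eq_ldot)
qed

lemma bounded_op_adjoint:
  assumes f: "bounded_op s1 s2 f" and g: "\<And>x y. ip2 (f x) y = ip1 x (g y)"
  shows "bounded_op s2 s1 g"
proof -
  interpret f: Vector_Spaces.linear s1 s2 f using f by (simp add: bounded_op_def)
  have gi: "inner x (g y) = inner (f x) y" for x y
    using inner_eq_of_ip_eq[OF g] by simp
  have "g (x + y) = g x + g y" for x y
    by (rule vector_eq_ldot[THEN iffD1]) (simp add: gi inner_add_right)
  moreover have "g (s2 c y) = s1 c (g y)" for c y
  proof (rule vector_eq_ldot[THEN iffD1], rule allI)
    fix x
    have "inner x (g (s2 c y)) = inner (s2 (kcnj c) (f x)) y"
      by (simp add: gi h2.inner_scale_left kcnj_kcnj)
    also have "\<dots> = inner x (s1 c (g y))"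
      unfolding f.scale[symmetric] gi[symmetric] by (simp add: h1.inner_scale_left kcnj_kcnj)
    finally show "inner x (g (s2 c y)) = inner x (s1 c (g y))" .
  qed
  ultimately have lin: "Vector_Spaces.linear s2 s1 g"
    by unfold_locales simp_all
  obtain K where K0: "0 \<le> K" and K: "\<And>x. norm (f x) \<le> norm x * K"
    using bounded_linear.nonneg_bounded[OF bounded_op_bounded_linear[OF f]] by blast
  have "norm (g y) \<le> norm y * K" for y
  proof (cases "g y = 0")
    case True
    then show ?thesis using K0 by simp
  next
    case False
    have "norm (g y) * norm (g y) = inner (f (g y)) y"
      by (simp add: gi[symmetric] dot_square_norm power2_eq_square)
    also have "\<dots> \<le> norm (f (g y)) * norm y" by (rule norm_cauchy_schwarz)
    also have "\<dots> \<le> norm (g y) * (norm y * K)"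
      using mult_right_mono[OF K[of "g y"], of "norm y"] by (simp add: mult_ac)
    finally show ?thesis using False by simp
  qed
  then show ?thesis unfolding bounded_op_def using lin by blast
qed

section \<open>From the range of an operator to the range of its product with the adjoint\<close>

text \<open>
  For \<open>N = R(f)\<close> one even has \<open>R(f f*) = R(f)\<close>.  In general take finite sets \<open>F\<close> and \<open>E\<close> with
  \<open>N \<subseteq> span (R(f) \<union> F)\<close> and \<open>R(f) \<subseteq> span (N \<union> E)\<close>, and put \<open>B = f f* + K\<close>, where \<open>K y = \<Sum>e\<in>F. \<langle>y, e\<rangle> e\<close>.

  The quadratic form \<open>q\<close> of \<open>B\<close> is coercive on \<open>N\<close>: by uniform boundedness it suffices that the set
  of \<open>y \<in> N\<close> with \<open>q y \<le> 1\<close> is weakly bounded, and \<open>\<bar>\<langle>y, z\<rangle>\<bar>\<close> is bounded on it both for \<open>z = f a\<close>, by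
  \<open>norm (f* y) * norm a\<close>, and for \<open>z \<in> F\<close>.

  So for \<open>h \<in> N\<close> some \<open>y \<in> N\<close> makes \<open>B y - h\<close> orthogonal to \<open>N\<close>.  As \<open>f (f* y)\<close> lies in \<open>N\<close> up to a
  vector of \<open>span E\<close>, the difference \<open>h - f (f* y)\<close> is a combination of the vectors of \<open>E \<union> F\<close> and their
  projections to \<open>N\<close>.
\<close>

lemma finite_over_range_comp_adjoint:
  assumes f: "bounded_op s1 s2 f" and adj: "\<And>x y. ip2 (f x) y = ip1 x (g y)"
    and N: "h2.subspace N" "closed N"
    and NR: "finite_over s2 N (range f)" and RN: "finite_over s2 (range f) N"
  shows "finite_over s2 N (range (f \<circ> g))"
proof -
  interpret f: Vector_Spaces.linear s1 s2 f using f by (simp add: bounded_op_def)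
  interpret h22: hilbert_space_pair s2 ip2 s2 ip2 ..
  interpret h21: hilbert_space_pair s2 ip2 s1 ip1 ..
  have g: "bounded_op s2 s1 g" by (rule bounded_op_adjoint[OF f adj])
  have blf: "bounded_linear f" by (rule bounded_op_bounded_linear[OF f])
  have blg: "bounded_linear g" by (rule h21.bounded_op_bounded_linear[OF g])
  have adji: "inner (f x) y = inner x (g y)" for x y by (rule inner_eq_of_ip_eq[OF adj])
  have Nr: "subspace N" by (rule h2.real_subspace[OF N(1)])
  obtain F where F: "finite F" "N \<subseteq> h2.span (range f \<union> F)"
    using NR unfolding finite_over_def by blast
  obtain E where E: "finite E" "range f \<subseteq> h2.span (N \<union> E)"
    using RN unfolding finite_over_def by blast

  define K where "K y = (\<Sum>e\<in>F. s2 (ip2 y e) e)" for y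
  define B where "B y = f (g y) + K y" for y
  define q where "q y = (norm (g y))\<^sup>2 + (\<Sum>e\<in>F. (norm (ip2 y e))\<^sup>2)" for y
  have blK: "bounded_linear K"
    unfolding K_def
  proof (intro bounded_linear_sum bounded_linear_intro)
    fix e x y and r :: real
    show "s2 (ip2 (x + y) e) e = s2 (ip2 x e) e + s2 (ip2 y e) e"
      by (simp add: h2.ip_add_left h2.scale_left_distrib)
    show "s2 (ip2 (r *\<^sub>R x) e) e = r *\<^sub>R s2 (ip2 x e) e"
      by (simp add: h2.scale_of_real[symmetric] h2.ip_scale_left)
    show "norm (s2 (ip2 x e) e) \<le> norm x * (norm e * norm e)"
      using mult_right_mono[OF h2.norm_ip_le[of x e], of "norm e"]
      by (simp add: h2.norm_scale mult.assoc)
  qed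
  have blB: "bounded_linear B"
    unfolding B_def using bounded_linear_add[OF bounded_linear_compose[OF blf blg] blK] .
  interpret B: bounded_linear B by (rule blB)
  have symK: "inner (K x) y = inner x (K y)" for x y
  proof -
    have "inner (s2 (ip2 x e) e) y = inner x (s2 (ip2 y e) e)" for e
      by (rule h22.inner_eq_of_ip_eq)
        (simp add: h2.ip_scale_left h2.ip_scale_right h2.ip_commute[of e y, symmetric])
    then show ?thesis by (simp add: K_def inner_sum_left inner_sum_right)
  qed
  have symB: "inner (B x) y = inner x (B y)" for x y
  proof -
    have "inner (f (g x)) y = inner (g x) (g y)" by (rule adji)
    moreover have "inner x (f (g y)) = inner (g x) (g y)"
      using adji[of "g y" x] by (simp add: inner_commute)
    ultimately show ?thesis by (simp add: B_def inner_add symK)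
  qed
  have Bq: "inner (B y) y = q y" for y
  proof -
    have "inner (s2 (ip2 y e) e) y = (norm (ip2 y e))\<^sup>2" for e
      using mult_kcnj[of "ip2 y e"]
      by (intro h2.inner_of_ip)
        (simp add: h2.ip_scale_left h2.ip_commute[of e y] of_real_def)
    then show ?thesis
      by (simp add: B_def q_def K_def inner_add_left inner_sum_left adji power2_norm_eq_inner)
  qed
  have qscale: "q (t *\<^sub>R y) = t\<^sup>2 * q y" for t y
    unfolding Bq[symmetric] by (simp add: B.scaleR power2_eq_square)
  have q0: "0 \<le> q y" for y by (simp add: q_def sum_nonneg)

  \<comment> \<open>the vectors with bounded products against \<open>Y\<close> form a subspace containing \<open>R(f)\<close> and \<open>F\<close>\<close>
  define Y where "Y = {y \<in> N. q y \<le> 1}"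
  have weak: "h2.span (range f \<union> F) \<subseteq> {z. \<exists>C. \<forall>y\<in>Y. norm (ip2 y z) \<le> C}"
  proof (rule h2.span_minimal)
    show "range f \<union> F \<subseteq> {z. \<exists>C. \<forall>y\<in>Y. norm (ip2 y z) \<le> C}"
    proof (intro Un_least subsetI CollectI)
      fix z assume "z \<in> range f"
      then obtain a where a: "z = f a" by blast
      have "norm (ip2 y z) \<le> norm a" if "y \<in> Y" for y
      proof -
        have "(norm (g y))\<^sup>2 \<le> 1"
          using that sum_nonneg[of F "\<lambda>e. (norm (ip2 y e))\<^sup>2"] by (simp add: Y_def q_def)
        then have "norm (g y) \<le> 1" by (simp add: power2_le_iff_abs_le abs_square_le_1)
        have "norm (ip2 y z) = norm (ip1 a (g y))"
          unfolding a by (simp add: h2.ip_commute[of y "f a"] adj)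
        also have "\<dots> \<le> norm a * norm (g y)" by (rule h1.norm_ip_le)
        also have "\<dots> \<le> norm a * 1" using \<open>norm (g y) \<le> 1\<close> by (intro mult_left_mono) auto
        finally show ?thesis by simp
      qed
      then show "\<exists>C. \<forall>y\<in>Y. norm (ip2 y z) \<le> C" by blast
    next
      fix z assume z: "z \<in> F"
      have "norm (ip2 y z) \<le> 1" if "y \<in> Y" for y
      proof -
        have "(norm (ip2 y z))\<^sup>2 \<le> (\<Sum>e\<in>F. (norm (ip2 y e))\<^sup>2)"
          using z F(1) by (intro member_le_sum) auto
        also have "\<dots> \<le> 1" using that by (simp add: Y_def q_def) (smt (verit) zero_le_power2)
        finally show ?thesis by (simp add: abs_square_le_1)
      qed
      then show "\<exists>C. \<forall>y\<in>Y. norm (ip2 y z) \<le> C" by blast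
    qed
    show "h2.subspace {z. \<exists>C. \<forall>y\<in>Y. norm (ip2 y z) \<le> C}"
    proof (rule h2.subspaceI)
      have "ip2 y 0 = 0" for y using h2.ip_scale_right[of y 0 0] by simp
      then show "0 \<in> {z. \<exists>C. \<forall>y\<in>Y. norm (ip2 y z) \<le> C}" by auto
    next
      fix u v
      assume "u \<in> {z. \<exists>C. \<forall>y\<in>Y. norm (ip2 y z) \<le> C}" "v \<in> {z. \<exists>C. \<forall>y\<in>Y. norm (ip2 y z) \<le> C}"
      then obtain C D where "\<forall>y\<in>Y. norm (ip2 y u) \<le> C" "\<forall>y\<in>Y. norm (ip2 y v) \<le> D" by blast
      then have "\<forall>y\<in>Y. norm (ip2 y (u + v)) \<le> C + D"
        by (auto simp: h2.ip_add_right intro: norm_triangle_mono)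
      then show "u + v \<in> {z. \<exists>C. \<forall>y\<in>Y. norm (ip2 y z) \<le> C}" by blast
    next
      fix c u
      assume "u \<in> {z. \<exists>C. \<forall>y\<in>Y. norm (ip2 y z) \<le> C}"
      then obtain C where "\<forall>y\<in>Y. norm (ip2 y u) \<le> C" by blast
      then have "\<forall>y\<in>Y. norm (ip2 y (s2 c u)) \<le> norm c * C"
        by (auto simp: h2.ip_scale_right norm_mult intro: mult_left_mono)
      then show "s2 c u \<in> {z. \<exists>C. \<forall>y\<in>Y. norm (ip2 y z) \<le> C}" by blast
    qed
  qed
  have "\<exists>C. \<forall>y\<in>Y. \<bar>inner y z\<bar> \<le> C" if "z \<in> N" for z
  proof -
    have "z \<in> {z. \<exists>C. \<forall>y\<in>Y. norm (ip2 y z) \<le> C}"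
      using that F(2) weak by (meson subsetD)
    then obtain C where C: "\<And>y. y \<in> Y \<Longrightarrow> norm (ip2 y z) \<le> C" by auto
    show ?thesis
      by (intro exI[of _ C] ballI order_trans[OF h2.abs_inner_le_norm_ip C])
  qed
  moreover have "Y \<subseteq> N" by (auto simp: Y_def)
  ultimately obtain C0 where C0: "\<And>y. y \<in> Y \<Longrightarrow> norm y \<le> C0"
    using weakly_bounded_imp_bounded[OF Nr N(2)] by metis
  define C where "C = max C0 1"
  have C: "C > 0" and CY: "\<And>y. y \<in> Y \<Longrightarrow> norm y \<le> C"
    using C0 by (auto simp: C_def le_max_iff_disj)
  have coercive: "1 / C\<^sup>2 * (norm y)\<^sup>2 \<le> inner (B y) y" if y: "y \<in> N" for y
  proof -
    have t: "\<bar>t\<bar> * norm y \<le> C" if "t\<^sup>2 * q y \<le> 1" for t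
    proof -
      have "t *\<^sub>R y \<in> Y" using y Nr that by (simp add: Y_def qscale subspace_scale)
      then show ?thesis using CY by fastforce
    qed
    \<comment> \<open>take the largest \<open>t\<close> that scales \<open>y\<close> into \<open>Y\<close>; if \<open>q y = 0\<close>, every \<open>t\<close> does\<close>
    have "(norm y)\<^sup>2 \<le> C\<^sup>2 * q y"
    proof (cases "q y = 0")
      case True
      then have "\<bar>2 * C / norm y\<bar> * norm y \<le> C" by (intro t) simp
      then have "norm y = 0" using C by (cases "norm y = 0") auto
      then show ?thesis using True by simp
    next
      case False
      then have q: "q y > 0" using q0[of y] by simp
      then have "\<bar>1 / sqrt (q y)\<bar> * norm y \<le> C" by (intro t) (simp add: power_divide)
      then have "norm y \<le> C * sqrt (q y)" using q by (simp add: field_simps)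
      then have "(norm y)\<^sup>2 \<le> (C * sqrt (q y))\<^sup>2" by (intro power_mono) auto
      then show ?thesis using q by (simp add: power_mult_distrib)
    qed
    then show ?thesis unfolding Bq using C by (simp add: field_simps)
  qed

  define M where "M = {w. \<forall>z\<in>N. inner w z = 0}"
  have M: "h2.subspace M" unfolding M_def by (rule h2.subspace_orthogonal[OF N(1)])
  have "\<exists>p. p \<in> N \<and> e - p \<in> M" for e
    using h2.orthogonal_projection[OF N, of e] unfolding M_def by auto
  then obtain P where P: "\<And>e. P e \<in> N" "\<And>e. e - P e \<in> M" by metis
  define G where "G = E \<union> F"
  have PG: "\<exists>p\<in>h2.span (P ` G). u - p \<in> M" if "u \<in> h2.span G" for u
    using that
  proof (induction rule: h2.span_induct_alt)
    case base
    show ?case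
      by (intro bexI[of _ 0]) (simp_all add: h2.span_zero h2.subspace_0[OF M])
  next
    case (step c x y)
    then obtain p where p: "p \<in> h2.span (P ` G)" "y - p \<in> M" by blast
    have "(s2 c x + y) - (s2 c (P x) + p) = s2 c (x - P x) + (y - p)"
      by (simp add: h2.scale_right_diff_distrib)
    also have "\<dots> \<in> M" using P(2) p(2) M by (intro h2.subspace_add h2.subspace_scale)
    finally show ?case
      by (rule bexI) (intro h2.span_add h2.span_scale h2.span_base imageI step(1) p(1))
  qed
  have "h \<in> h2.span (range (f \<circ> g) \<union> (G \<union> P ` G))" if h: "h \<in> N" for h
  proof -
    obtain y where y: "y \<in> N" "\<And>z. z \<in> N \<Longrightarrow> inner (B y) z = inner h z"
      using coercive_variational[OF blB symB bounded_linear_inner_right[of h] Nr N(2) _ coercive] C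
      by auto
    have "f (g y) \<in> h2.span (N \<union> E)" using E(2) by blast
    moreover have "h2.span N = N" using N(1) by simp
    ultimately have "f (g y) \<in> {n + e |n e. n \<in> N \<and> e \<in> h2.span E}"
      by (simp only: h2.span_Un)
    then obtain n e where ne: "n \<in> N" "e \<in> h2.span E" "f (g y) = n + e"
      unfolding mem_Collect_eq by (elim exE conjE) (rule that)
    define u where "u = e + K y"
    have KF: "K y \<in> h2.span F"
      unfolding K_def by (intro h2.span_sum h2.span_scale h2.span_base)
    have u: "u \<in> h2.span G"
      using ne(2) KF h2.span_mono[of E G] h2.span_mono[of F G]
      unfolding u_def G_def by (intro h2.span_add) auto
    obtain p where p: "p \<in> h2.span (P ` G)" "u - p \<in> M" using PG[OF u] by blast
    have pN: "p \<in> N" using p(1) P(1) N(1) h2.span_minimal[of "P ` G" N] by blast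
    have "B y - h \<in> M" using y(2) by (simp add: M_def inner_diff_left)
    then have "(B y - h) - (u - p) \<in> M" using p(2) by (rule h2.subspace_diff[OF M])
    moreover have nph: "(B y - h) - (u - p) = n + p - h"
      by (simp add: B_def u_def ne(3))
    moreover have "n + p - h \<in> N"
      using ne(1) pN h N(1) by (intro h2.subspace_diff h2.subspace_add)
    ultimately have "inner (n + p - h) (n + p - h) = 0" unfolding M_def by simp
    then have "n + p - h = 0" by (simp only: inner_eq_zero_iff)
    then have "h = f (g y) + K y - u + p" using nph by (simp add: B_def algebra_simps)
    moreover have "f (g y) \<in> h2.span (range (f \<circ> g) \<union> (G \<union> P ` G))"
      by (intro h2.span_base) auto
    moreover have "K y \<in> h2.span (range (f \<circ> g) \<union> (G \<union> P ` G))"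
      using KF h2.span_mono[of F "range (f \<circ> g) \<union> (G \<union> P ` G)"] unfolding G_def by blast
    moreover have "u \<in> h2.span (range (f \<circ> g) \<union> (G \<union> P ` G))"
      using u h2.span_mono[of G "range (f \<circ> g) \<union> (G \<union> P ` G)"] by blast
    moreover have "p \<in> h2.span (range (f \<circ> g) \<union> (G \<union> P ` G))"
      using p(1) h2.span_mono[of "P ` G" "range (f \<circ> g) \<union> (G \<union> P ` G)"] by blast
    ultimately show ?thesis by (simp add: h2.span_add h2.span_diff)
  qed
  moreover have "finite (G \<union> P ` G)" using E(1) F(1) by (simp add: G_def)
  ultimately show ?thesis unfolding finite_over_def by blast
qed

end

section \<open>Fredholm operators\<close>

lemma bounded_op_compose:
  assumes "bounded_op s1 s2 f" "bounded_op s2 s3 g"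
  shows "bounded_op s1 s3 (\<lambda>x. g (f x))"
proof -
  obtain K L where K: "\<And>x. norm (f x) \<le> norm x * K" and L: "\<And>x. norm (g x) \<le> norm x * L"
    using assms unfolding bounded_op_def by blast
  have "norm (g (f x)) \<le> norm x * (K * \<bar>L\<bar>)" for x
  proof -
    have "norm (g (f x)) \<le> norm (f x) * \<bar>L\<bar>"
      using L[of "f x"] by (meson abs_ge_self mult_left_mono norm_ge_zero order_trans)
    also have "\<dots> \<le> (norm x * K) * \<bar>L\<bar>" using K by (intro mult_right_mono) auto
    finally show ?thesis by (simp add: mult.assoc)
  qed
  moreover have "Vector_Spaces.linear s1 s3 (\<lambda>x. g (f x))"
    using Vector_Spaces.linear_compose[of s1 s2 f s3 g] assms by (simp add: bounded_op_def o_def)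
  ultimately show ?thesis unfolding bounded_op_def by blast
qed

lemma bounded_op_add:
  assumes "bounded_op s1 s2 f" "bounded_op s1 s2 g"
  shows "bounded_op s1 s2 (\<lambda>x. f x + g x)"
proof -
  interpret f: Vector_Spaces.linear s1 s2 f using assms(1) by (simp add: bounded_op_def)
  interpret g: Vector_Spaces.linear s1 s2 g using assms(2) by (simp add: bounded_op_def)
  obtain K L where K: "\<And>x. norm (f x) \<le> norm x * K" and L: "\<And>x. norm (g x) \<le> norm x * L"
    using assms unfolding bounded_op_def by blast
  have "norm (f x + g x) \<le> norm x * (K + L)" for x
    using norm_triangle_mono[OF K[of x] L[of x]] by (simp add: distrib_left)
  moreover have "Vector_Spaces.linear s1 s2 (\<lambda>x. f x + g x)"
    by unfold_locales
      (simp_all add: f.add g.add f.scale g.scale f.vs2.scale_right_distrib)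
  ultimately show ?thesis unfolding bounded_op_def by blast
qed

lemma fredholm_op_iff:
  assumes f: "bounded_op s s f"
  shows "fredholm_op s f \<longleftrightarrow>
    finite_over s (null_space f) {0} \<and> finite_over s UNIV (range f)"
proof -
  interpret f: Vector_Spaces.linear s s f using f by (simp add: bounded_op_def)
  show ?thesis
    unfolding fredholm_op_def f.vs1.finite_dim_iff[OF f.subspace_null_space]
      f.vs1.quotient_dim_finite_iff[OF f.vs1.subspace_UNIV f.subspace_range subset_UNIV]
    using f by blast
qed

context hilbert_space
begin

text \<open>
  The null space of a self-adjoint operator meets the range only in 0.  If the whole space is finite
  over the range then so is the null space, which is therefore finite dimensional.
\<close>

lemma self_adjoint_fredholm_iff:
  assumes f: "bounded_op scale scale f" and sa: "\<And>x y. ip (f x) y = ip x (f y)"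
  shows "fredholm_op scale f \<longleftrightarrow> finite_over scale UNIV (range f)"
proof -
  interpret hilbert_space_pair scale ip scale ip ..
  interpret f: Vector_Spaces.linear scale scale f using f by (simp add: bounded_op_def)
  have "finite_over scale (null_space f) {0}" if R: "finite_over scale UNIV (range f)"
  proof -
    have "finite_over scale (null_space f) (range f)"
      by (rule finite_over_mono[OF R]) (auto intro: span_base)
    then have "finite_over scale (null_space f) (null_space f \<inter> range f)"
      by (rule finite_over_Int[OF f.subspace_null_space f.subspace_range])
    moreover have "null_space f \<inter> range f \<subseteq> {0}"
    proof clarsimp
      fix x assume "f x \<in> null_space f"
      then have "inner (f x) (f x) = 0"
        using inner_eq_of_ip_eq[OF sa, of x "f x"] by (simp add: null_space_def)
      then show "f x = 0" by simp
    qed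
    ultimately show ?thesis
      by (elim finite_over_mono) (auto intro: span_base)
  qed
  then show ?thesis using fredholm_op_iff[OF f] by blast
qed

lemma adjoint_sym:
  assumes "\<And>x y. ip (f x) y = ip x (g y)"
  shows "ip (g x) y = ip x (f y)"
  using assms[of y x] ip_commute[of "g x" y] ip_commute[of x "f y"] by simp

lemma range_adjoint_Int_null_space:
  assumes adj: "\<And>x y. ip (f x) y = ip x (g y)" and "f 0 = 0" "g 0 = 0"
  shows "range g \<inter> null_space f = {0}"
proof -
  interpret hilbert_space_pair scale ip scale ip ..
  have "g x = 0" if "f (g x) = 0" for x
  proof -
    have "inner (g x) (g x) = 0"
      using inner_eq_of_ip_eq[OF adj, of "g x" x] that by simp
    then show ?thesis by simp
  qed
  then show ?thesis using assms(2) rangeI[of g 0] assms(3) by (auto simp: null_space_def)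
qed

text \<open>
  The map \<open>f\<close> embeds \<open>R(f*)\<close> into \<open>R(f)\<close>.
\<close>

lemma finite_rank_adjoint:
  assumes f: "bounded_op scale scale f" and adj: "\<And>x y. ip (f x) y = ip x (g y)"
    and fin: "finite_over scale (range f) {0}"
  shows "finite_over scale (range g) {0}"
proof -
  interpret hilbert_space_pair scale ip scale ip ..
  interpret f: Vector_Spaces.linear scale scale f using f by (simp add: bounded_op_def)
  interpret g: Vector_Spaces.linear scale scale g
    using bounded_op_adjoint[OF f adj] by (simp add: bounded_op_def)
  have "finite_over scale (f ` range g) {0}"
    by (rule finite_over_mono[OF fin]) (auto intro: span_base)
  then have "finite_over scale (range g) (range g \<inter> null_space f)"
    by (rule f.finite_over_Int_null_space[OF g.subspace_range])
  then show ?thesis using range_adjoint_Int_null_space[OF adj f.zero g.zero] by simp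
qed

text \<open>
  From left to right, \<open>finite_over_range_comp_adjoint\<close> makes \<open>N(U)\<close> finite over \<open>R(UU*)\<close>, and \<open>R(UU*)\<close>
  and \<open>U*(N(U))\<close> are finite over the range of \<open>U + U*\<close>.  From right to left, injectivity of \<open>U\<close> on
  \<open>R(U*)\<close> confines the component in \<open>R(U*)\<close> of a vector of \<open>N(U)\<close> to a finite-dimensional space.
\<close>

lemma null_space_over_range_iff:
  assumes U: "bounded_op scale scale U" and adj: "\<And>x y. ip (U x) y = ip x (U' y)"
    and fin: "finite_over scale (range (U \<circ> U)) {0}"
  shows "finite_over scale (null_space U) (range U) \<longleftrightarrow>
    finite_over scale UNIV (range (\<lambda>x. U x + U' x))" (is "?N \<longleftrightarrow> ?R")
proof -
  interpret hilbert_space_pair scale ip scale ip ..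
  have U': "bounded_op scale scale U'" by (rule bounded_op_adjoint[OF U adj])
  interpret U: Vector_Spaces.linear scale scale U using U by (simp add: bounded_op_def)
  interpret U': Vector_Spaces.linear scale scale U' using U' by (simp add: bounded_op_def)
  have inj: "range U' \<inter> null_space U = {0}"
    by (rule range_adjoint_Int_null_space[OF adj U.zero U'.zero])
  show ?thesis
  proof
    assume ?R
    then have "finite_over scale UNIV (range U \<union> range U')"
      by (rule finite_over_mono) (auto intro: span_add[OF span_base span_base])
    then obtain F where F: "finite F" "UNIV = span (range U \<union> range U' \<union> F)"
      unfolding finite_over_def by blast
    define G where "G = span (range (U \<circ> U) \<union> U ` F)"
    \<comment> \<open>the possible components in \<open>R(U*)\<close> of vectors of \<open>N(U)\<close>\<close>
    define E where "E = range U' \<inter> U -` G"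
    have E: "subspace E"
      unfolding E_def G_def
      by (intro subspace_inter U'.subspace_range U.subspace_vimage subspace_span)
    have "finite_over scale (U ` F) {0}"
      unfolding finite_over_def using F(1) span_superset[of "{0} \<union> U ` F"] by blast
    then have "finite_over scale G {0}"
      unfolding G_def using fin by (intro finite_over_Un)
    then have "finite_over scale (U ` E) {0}"
      by (rule finite_over_mono) (auto simp: E_def intro: span_base)
    then have "finite_over scale E (E \<inter> null_space U)"
      by (rule U.finite_over_Int_null_space[OF E])
    moreover have "E \<inter> null_space U \<subseteq> {0}" using inj unfolding E_def by blast
    ultimately have E0: "finite_over scale E {}"
      unfolding finite_over_empty_iff by (elim finite_over_mono) (auto intro: span_base)
    have "y \<in> span (range U \<union> (E \<union> F))" if y: "y \<in> null_space U" for y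
    proof -
      have "y \<in> span (range U \<union> (range U' \<union> F))" using F(2) by (auto simp: Un_assoc)
      then obtain a b f where abf: "a \<in> range U" "b \<in> range U'" "f \<in> span F" "y = a + (b + f)"
        using span_eq_iff[THEN iffD2, OF U.subspace_range]
          span_eq_iff[THEN iffD2, OF U'.subspace_range]
        unfolding span_Un by (simp only: mem_Collect_eq) metis
      have "U b = - U a - U f"
        using y abf(4) by (simp add: null_space_def U.add eq_neg_iff_add_eq_0 algebra_simps)
      moreover have "U a \<in> G"
        unfolding G_def using abf(1) by (auto intro!: span_base)
      moreover have "U f \<in> G"
        unfolding G_def using abf(3) U.span_image[of F] span_mono[of "U ` F"] by blast
      ultimately have "U b \<in> G" unfolding G_def by (simp add: span_diff span_neg)
      then have "b \<in> E" using abf(2) by (simp add: E_def)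
      then show ?thesis
        using abf span_mono[of F "range U \<union> (E \<union> F)"]
        by (auto intro!: span_add intro: span_base)
    qed
    then have "finite_over scale (null_space U) (range U \<union> E)"
      unfolding finite_over_def using F(1) by (auto simp: Un_assoc)
    moreover have "finite_over scale (range U \<union> E) (range U)"
      using finite_over_Un[of "range U" "range U" E] finite_over_subset[of "range U" "range U"]
        finite_over_mono[OF E0, of E "range U"]
      by (meson empty_subsetI finite_over_mono order_refl span_superset)
    ultimately show ?N by (rule finite_over_trans)
  next
    assume N: ?N
    let ?V = "\<lambda>x. U x + U' x"
    have "finite_over scale (U ` range U) {0}" using fin by (simp add: image_comp)
    then have "finite_over scale (range U) (range U \<inter> null_space U)"
      by (rule U.finite_over_Int_null_space[OF U.subspace_range])
    then have RN: "finite_over scale (range U) (null_space U)"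
      by (rule finite_over_mono) (auto intro: span_base)
    have "continuous_on UNIV U"
      by (rule linear_continuous_on[OF bounded_op_bounded_linear[OF U]])
    then have "closed (null_space U)"
      unfolding null_space_def by (intro closed_Collect_eq continuous_on_const)
    then have NU: "finite_over scale (null_space U) (range (U \<circ> U'))"
      by (rule finite_over_range_comp_adjoint[OF U adj U.subspace_null_space _ N RN])
    have U2': "finite_over scale (range (U' \<circ> U')) {}"
      unfolding finite_over_empty_iff
    proof (rule finite_rank_adjoint[OF _ _ fin])
      show "bounded_op scale scale (U \<circ> U)"
        using bounded_op_compose[OF U U] by (simp add: o_def)
    qed (simp add: adj)
    have emb: "finite_over scale (range ?V \<union> range (U' \<circ> U')) (range ?V)"
      using finite_over_Un[of "range ?V" "range ?V" "range (U' \<circ> U')"]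
        finite_over_subset[of "range ?V" "range ?V"]
        finite_over_mono[OF U2', of "range (U' \<circ> U')" "range ?V"]
      by (meson empty_subsetI finite_over_mono order_refl span_superset)
    \<comment> \<open>\<open>U\<close> maps the whole space into \<open>R(UU*)\<close>, hence the space into \<open>N(U) + R(U*)\<close>, up to finite dimension\<close>
    have "finite_over scale (U ` UNIV) (range (U \<circ> U'))"
      by (rule finite_over_trans[OF RN NU])
    moreover have "subspace (range (U \<circ> U'))"
      using U.subspace_image[OF U'.subspace_range] by (simp add: image_comp)
    ultimately have "finite_over scale UNIV (UNIV \<inter> U -` range (U \<circ> U'))"
      using U.finite_over_vimage[OF subspace_UNIV] by blast
    moreover have "x \<in> span (null_space U \<union> range U')" if "U x \<in> range (U \<circ> U')" for x
    proof -
      obtain z where "U x = U (U' z)" using \<open>U x \<in> range (U \<circ> U')\<close> by auto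
      then have "x - U' z \<in> null_space U" by (simp add: null_space_def U.diff)
      then have "(x - U' z) + U' z \<in> span (null_space U \<union> range U')"
        by (intro span_add span_base) auto
      then show ?thesis by simp
    qed
    ultimately have H: "finite_over scale UNIV (null_space U \<union> range U')"
      by (elim finite_over_mono) auto
    have "finite_over scale (U' ` UNIV) (U' ` (null_space U \<union> range U'))"
      by (rule U'.finite_over_image[OF H])
    moreover have "U' ` (null_space U \<union> range U') \<subseteq> range ?V \<union> range (U' \<circ> U')"
    proof -
      have "U' x \<in> range ?V" if "x \<in> null_space U" for x
        using that rangeI[of ?V x] by (simp add: null_space_def)
      then show ?thesis by auto
    qed
    ultimately have "finite_over scale (range U') (range ?V \<union> range (U' \<circ> U'))"
      by (meson finite_over_mono order_refl span_superset subset_trans)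
    then have RV: "finite_over scale (range U') (range ?V)"
      by (rule finite_over_trans[OF _ emb])
    have "U (U' x) \<in> span (range ?V \<union> range (U' \<circ> U'))" for x
    proof -
      have "?V (U' x) - (U' \<circ> U') x \<in> span (range ?V \<union> range (U' \<circ> U'))"
        by (intro span_diff span_base) blast+
      then show ?thesis by simp
    qed
    then have "finite_over scale (range (U \<circ> U')) (range ?V \<union> range (U' \<circ> U'))"
      by (intro finite_over_subset) auto
    then have "finite_over scale (null_space U) (range ?V)"
      using NU emb finite_over_trans by blast
    then have "finite_over scale (null_space U \<union> range U') (range ?V)"
      using finite_over_Un[OF _ RV] by (meson finite_over_mono order_refl span_superset)
    then show ?R by (rule finite_over_trans[OF H])
  qed
qed

end

lemma (in hilbert_space) square_fredholm_iff:
  assumes V: "bounded_op scale scale V" and sa: "\<And>x y. ip (V x) y = ip x (V y)"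
  shows "fredholm_op scale (V \<circ> V) \<longleftrightarrow> fredholm_op scale V"
proof -
  have "bounded_op scale scale (V \<circ> V)" using bounded_op_compose[OF V V] by (simp add: o_def)
  moreover have "ip ((V \<circ> V) x) y = ip x ((V \<circ> V) y)" for x y by (simp add: sa)
  ultimately show ?thesis
    using finite_over_UNIV_square[of scale V] V
    by (simp add: self_adjoint_fredholm_iff[OF V sa] self_adjoint_fredholm_iff bounded_op_def)
qed

lemma (in hilbert_space) finite_rank_perturbation:
  assumes "finite_over scale (range K) {0}" "\<And>x. f x = g x + K x"
    "finite_over scale UNIV (range f)"
  shows "finite_over scale UNIV (range g)"
proof -
  have "finite_over scale (range K) (range g)"
    using assms(1) by (rule finite_over_mono) (auto intro: span_zero)
  then have "finite_over scale (span (range g \<union> range K)) (range g)"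
    by (rule finite_over_Un[OF finite_over_subset[OF span_superset]])
  moreover have "range f \<subseteq> span (range g \<union> range K)"
    unfolding assms(2) by (auto intro: span_add[OF span_base span_base])
  ultimately have "finite_over scale (range f) (range g)"
    by (meson finite_over_mono order_refl span_superset)
  then show ?thesis using assms(3) finite_over_trans by blast
qed

lemma (in hilbert_space) square_fredholm_iff_diagonal_part:
  assumes U: "bounded_op scale scale U" and adj: "\<And>x y. ip (U x) y = ip x (U' y)"
    and fin: "finite_over scale (range (U \<circ> U)) {0}"
  defines "V \<equiv> \<lambda>x. U x + U' x"
  shows "fredholm_op scale (V \<circ> V) \<longleftrightarrow> fredholm_op scale (\<lambda>x. U (U' x) + U' (U x))"
proof -
  interpret hilbert_space_pair scale ip scale ip ..
  have U': "bounded_op scale scale U'" by (rule bounded_op_adjoint[OF U adj])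
  interpret U: Vector_Spaces.linear scale scale U using U by (simp add: bounded_op_def)
  interpret U': Vector_Spaces.linear scale scale U' using U' by (simp add: bounded_op_def)
  have adj': "ip (U' x) y = ip x (U y)" for x y by (rule adjoint_sym[OF adj])
  let ?W = "\<lambda>x. U (U' x) + U' (U x)"
  let ?K = "\<lambda>x. U (U x) + U' (U' x)"
  have VV: "(V \<circ> V) x = ?W x + ?K x" for x
    by (simp add: V_def U.add U'.add algebra_simps)
  have bV: "bounded_op scale scale V" unfolding V_def by (rule bounded_op_add[OF U U'])
  have bVV: "bounded_op scale scale (V \<circ> V)" using bounded_op_compose[OF bV bV] by (simp add: o_def)
  have bW: "bounded_op scale scale ?W"
    by (intro bounded_op_add bounded_op_compose[OF U U'] bounded_op_compose[OF U' U])
  have saV: "ip (V x) y = ip x (V y)" for x y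
    by (simp add: V_def ip_add_left ip_add_right adj adj' add.commute)
  have saW: "ip (?W x) y = ip x (?W y)" for x y
    by (simp add: ip_add_left ip_add_right adj adj')
  have bUU: "bounded_op scale scale (U \<circ> U)" using bounded_op_compose[OF U U] by (simp add: o_def)
  have "finite_over scale (range (U' \<circ> U')) {0}"
    by (rule finite_rank_adjoint[OF bUU _ fin]) (simp add: adj)
  then have "finite_over scale (span (range (U \<circ> U) \<union> range (U' \<circ> U'))) {0}"
    by (rule finite_over_Un[OF fin])
  moreover have "range ?K \<subseteq> span (range (U \<circ> U) \<union> range (U' \<circ> U'))"
    by (auto intro: span_add[OF span_base span_base])
  moreover have "range (\<lambda>x. - ?K x) \<subseteq> span (range (U \<circ> U) \<union> range (U' \<circ> U'))"
    by (auto intro!: span_neg span_diff[OF span_neg[OF span_base] span_base])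
  ultimately have K: "finite_over scale (range ?K) {0}" "finite_over scale (range (\<lambda>x. - ?K x)) {0}"
    by (meson finite_over_mono span_superset)+
  have WV: "?W x = (V \<circ> V) x + - ?K x" for x unfolding VV by simp
  have "finite_over scale UNIV (range (V \<circ> V)) \<longleftrightarrow> finite_over scale UNIV (range ?W)"
    using finite_rank_perturbation[OF K(1) VV] finite_rank_perturbation[OF K(2) WV] by blast
  then show ?thesis
    using self_adjoint_fredholm_iff[OF bVV] self_adjoint_fredholm_iff[OF bW saW]
    by (simp add: saV)
qed

lemma fredholm_op_block_diagonal:
  fixes A :: "'a::real_normed_vector \<Rightarrow> 'a" and B :: "'b::real_normed_vector \<Rightarrow> 'b"
  assumes A: "bounded_op s1 s1 A" and B: "bounded_op s2 s2 B"
    and W: "bounded_op (sum_scale s1 s2) (sum_scale s1 s2) (\<lambda>(x, y). (A x, B y))"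
  shows "fredholm_op (sum_scale s1 s2) (\<lambda>(x, y). (A x, B y)) \<longleftrightarrow>
    fredholm_op s1 A \<and> fredholm_op s2 B"
proof -
  interpret A: Vector_Spaces.linear s1 s1 A using A by (simp add: bounded_op_def)
  interpret B: Vector_Spaces.linear s2 s2 B using B by (simp add: bounded_op_def)
  note Times = finite_over_Times_iff[OF A.vs1.vector_space_axioms B.vs1.vector_space_axioms]
  let ?W = "\<lambda>(x, y). (A x, B y)"
  have null: "null_space ?W = null_space A \<times> null_space B"
    by (auto simp: null_space_def zero_prod_def)
  have ran: "range ?W = range A \<times> range B" by (auto simp: image_iff)
  have zero: "{0 :: 'a \<times> 'b} = {0} \<times> {0}" by (simp add: zero_prod_def)
  have zeros: "0 \<in> null_space A" "0 \<in> null_space B" "0 \<in> range A" "0 \<in> range B"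
    using rangeI[of A 0] rangeI[of B 0] by (simp_all add: null_space_def)
  have "finite_over (sum_scale s1 s2) (null_space ?W) {0} \<longleftrightarrow>
      finite_over s1 (null_space A) {0} \<and> finite_over s2 (null_space B) {0}"
    unfolding null zero by (rule Times) (simp_all add: zeros)
  moreover have "finite_over (sum_scale s1 s2) UNIV (range ?W) \<longleftrightarrow>
      finite_over s1 UNIV (range A) \<and> finite_over s2 UNIV (range B)"
    using Times[of UNIV UNIV "range A" "range B"] zeros unfolding ran by simp
  ultimately show ?thesis
    unfolding fredholm_op_iff[OF A] fredholm_op_iff[OF B] fredholm_op_iff[OF W] by blast
qed

text \<open>
  The quotients \<open>R(T) / (N(S) \<inter> R(T))\<close> and \<open>R(S) / (N(T) \<inter> R(S))\<close> are finite dimensional because they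
  are isomorphic to \<open>R(ST)\<close> and \<open>R(TS)\<close>.
\<close>

lemma fredholm_pair_iff:
  assumes S: "bounded_op s1 s2 S" and T: "bounded_op s2 s1 T"
    and TS: "finite_dim s1 (range (T \<circ> S))" and ST: "finite_dim s2 (range (S \<circ> T))"
  shows "fredholm_pair s1 s2 S T \<longleftrightarrow>
    finite_over s1 (null_space S) (range T) \<and> finite_over s2 (null_space T) (range S)"
proof -
  interpret S: Vector_Spaces.linear s1 s2 S using S by (simp add: bounded_op_def)
  interpret T: Vector_Spaces.linear s2 s1 T using T by (simp add: bounded_op_def)
  note sub = S.subspace_range T.subspace_range S.subspace_null_space T.subspace_null_space
  have "S.vs1.subspace (range (T \<circ> S))" "S.vs2.subspace (range (S \<circ> T))"
    using T.subspace_image[OF S.subspace_range] S.subspace_image[OF T.subspace_range]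
    by (simp_all add: image_comp)
  then have fin: "finite_over s1 (T ` range S) {0}" "finite_over s2 (S ` range T) {0}"
    using TS ST by (simp_all add: S.vs1.finite_dim_iff S.vs2.finite_dim_iff image_comp)
  have "finite_over s1 (range T) (null_space S \<inter> range T)"
    using S.finite_over_Int_null_space[OF T.subspace_range fin(2)] by (simp add: Int_commute)
  moreover have "finite_over s2 (range S) (null_space T \<inter> range S)"
    using T.finite_over_Int_null_space[OF S.subspace_range fin(1)] by (simp add: Int_commute)
  moreover have "finite_over s1 (null_space S) (null_space S \<inter> range T) \<longleftrightarrow>
      finite_over s1 (null_space S) (range T)"
    using S.vs1.finite_over_Int[OF sub(3,2)]
      S.vs1.finite_over_mono[of "null_space S" "null_space S \<inter> range T" "null_space S" "range T"]
      S.vs1.span_superset[of "range T"] by blast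
  moreover have "finite_over s2 (null_space T) (null_space T \<inter> range S) \<longleftrightarrow>
      finite_over s2 (null_space T) (range S)"
    using S.vs2.finite_over_Int[OF sub(4,1)]
      S.vs2.finite_over_mono[of "null_space T" "null_space T \<inter> range S" "null_space T" "range S"]
      S.vs2.span_superset[of "range S"] by blast
  ultimately show ?thesis
    unfolding fredholm_pair_def
    using S T sub S.vs1.subspace_inter S.vs2.subspace_inter
    by (simp add: S.vs1.quotient_dim_finite_iff S.vs2.quotient_dim_finite_iff
        del: enat_ord_simps not_infinity_eq)
qed

lemma bounded_op_off_diagonal:
  assumes "hilbert_space s1 ip1" "hilbert_space s2 ip2"
    and S: "bounded_op s1 s2 S" and T: "bounded_op s2 s1 T"
  shows "bounded_op (sum_scale s1 s2) (sum_scale s1 s2) (\<lambda>(x1, x2). (T x2, S x1))"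
proof -
  interpret h1: hilbert_space s1 ip1 by fact
  interpret h2: hilbert_space s2 ip2 by fact
  interpret p: vector_space_prod s1 s2 ..
  interpret S: Vector_Spaces.linear s1 s2 S using S by (simp add: bounded_op_def)
  interpret T: Vector_Spaces.linear s2 s1 T using T by (simp add: bounded_op_def)
  interpret h12: hilbert_space_pair s1 ip1 s2 ip2 ..
  interpret h21: hilbert_space_pair s2 ip2 s1 ip1 ..
  have "Vector_Spaces.linear (sum_scale s1 s2) (sum_scale s1 s2) (\<lambda>(x1, x2). (T x2, S x1))"
    by unfold_locales (auto simp: p.scale_def S.add T.add S.scale T.scale)
  moreover obtain K where K: "0 \<le> K" "\<And>x. norm (S x) \<le> norm x * K"
    using bounded_linear.nonneg_bounded[OF h12.bounded_op_bounded_linear[OF S]] by blast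
  moreover obtain L where L: "0 \<le> L" "\<And>x. norm (T x) \<le> norm x * L"
    using bounded_linear.nonneg_bounded[OF h21.bounded_op_bounded_linear[OF T]] by blast
  have "norm (T x2, S x1) \<le> norm (x1, x2) * (L + K)" for x1 x2
  proof -
    have "norm (T x2, S x1) \<le> norm (T x2) + norm (S x1)" by (rule norm_Pair_le)
    also have "\<dots> \<le> norm x2 * L + norm x1 * K" by (intro add_mono K L)
    also have "\<dots> \<le> norm (x1, x2) * L + norm (x1, x2) * K"
      using norm_fst_le[of x1 x2] norm_snd_le[of x2 x1] K(1) L(1)
      by (intro add_mono mult_right_mono) auto
    finally show ?thesis by (simp add: distrib_left)
  qed
  then have "\<exists>K. \<forall>x. norm (case x of (x1, x2) \<Rightarrow> (T x2, S x1)) \<le> norm x * K" by auto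
  ultimately show ?thesis unfolding bounded_op_def by blast
qed

section \<open>The equivalences\<close>

theorem theorem3p5:
  fixes s1 :: "'k::real_or_complex \<Rightarrow> 'a::{real_inner, complete_space} \<Rightarrow> 'a"
    and s2 :: "'k \<Rightarrow> 'b::{real_inner, complete_space} \<Rightarrow> 'b"
    and ip1 :: "'a \<Rightarrow> 'a \<Rightarrow> 'k" and ip2 :: "'b \<Rightarrow> 'b \<Rightarrow> 'k"
    and S T' :: "'a \<Rightarrow> 'b" and T S' :: "'b \<Rightarrow> 'a"
    and U U' V :: "'a \<times> 'b \<Rightarrow> 'a \<times> 'b"
  assumes H1: "hilbert_space s1 ip1" and H2: "hilbert_space s2 ip2"
    and S: "bounded_op s1 s2 S" and T: "bounded_op s2 s1 T"
    and TS: "finite_dim s1 (range (T \<circ> S))" and ST: "finite_dim s2 (range (S \<circ> T))"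
    and U: "U = (\<lambda>(x1, x2). (T x2, S x1))"
    and S': "S' = hilbert_adjoint ip1 ip2 S" and T': "T' = hilbert_adjoint ip2 ip1 T"
    and U': "U' = hilbert_adjoint (sum_ip ip1 ip2) (sum_ip ip1 ip2) U"
    and V: "V = (\<lambda>x. U x + U' x)"
  shows "(fredholm_pair s1 s2 S T \<longleftrightarrow> fredholm_op (sum_scale s1 s2) V) \<and>
    (fredholm_op (sum_scale s1 s2) V \<longleftrightarrow> fredholm_op (sum_scale s1 s2) (V \<circ> V)) \<and>
    (fredholm_op (sum_scale s1 s2) (V \<circ> V) \<longleftrightarrow>
      fredholm_op (sum_scale s1 s2) (\<lambda>x. U (U' x) + U' (U x))) \<and>
    (fredholm_op (sum_scale s1 s2) (\<lambda>x. U (U' x) + U' (U x)) \<longleftrightarrow>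
      fredholm_op s1 (\<lambda>x. T (T' x) + S' (S x)) \<and> fredholm_op s2 (\<lambda>y. S (S' y) + T' (T y)))"
proof -
  interpret h1: hilbert_space s1 ip1 by fact
  interpret h2: hilbert_space s2 ip2 by fact
  interpret h: hilbert_space "sum_scale s1 s2" "sum_ip ip1 ip2" by (rule hilbert_space_sum[OF H1 H2])
  interpret h12: hilbert_space_pair s1 ip1 s2 ip2 ..
  interpret h21: hilbert_space_pair s2 ip2 s1 ip1 ..
  interpret hh: hilbert_space_pair "sum_scale s1 s2" "sum_ip ip1 ip2" "sum_scale s1 s2" "sum_ip ip1 ip2" ..
  interpret S: Vector_Spaces.linear s1 s2 S using S by (simp add: bounded_op_def)
  interpret T: Vector_Spaces.linear s2 s1 T using T by (simp add: bounded_op_def)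
  have adjS: "ip2 (S x) y = ip1 x (S' y)" for x y
    unfolding S' by (rule h12.hilbert_adjoint_ip[OF S])
  have adjT: "ip1 (T x) y = ip2 x (T' y)" for x y
    unfolding T' by (rule h21.hilbert_adjoint_ip[OF T])
  have bS': "bounded_op s2 s1 S'" by (rule h12.bounded_op_adjoint[OF S adjS])
  have bT': "bounded_op s1 s2 T'" by (rule h21.bounded_op_adjoint[OF T adjT])
  have bU: "bounded_op (sum_scale s1 s2) (sum_scale s1 s2) U"
    unfolding U by (rule bounded_op_off_diagonal[OF H1 H2 S T])
  have U'_eq: "U' = (\<lambda>(x1, x2). (S' x2, T' x1))"
    unfolding U'
    by (rule hh.hilbert_adjoint_eqI[OF bU]) (auto simp: U sum_ip_def adjS adjT add.commute)
  have adj: "sum_ip ip1 ip2 (U x) y = sum_ip ip1 ip2 x (U' y)" for x y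
    unfolding U' by (rule hh.hilbert_adjoint_ip[OF bU])
  have bU': "bounded_op (sum_scale s1 s2) (sum_scale s1 s2) U'"
    by (rule hh.bounded_op_adjoint[OF bU adj])
  have adj': "sum_ip ip1 ip2 (U' x) y = sum_ip ip1 ip2 x (U y)" for x y
    by (rule h.adjoint_sym[OF adj])
  have zero: "{0 :: 'a \<times> 'b} = {0} \<times> {0}" by (simp add: zero_prod_def)
  have zeros: "0 \<in> range S" "0 \<in> range T" "0 \<in> null_space S" "0 \<in> null_space T"
    "0 \<in> range (T \<circ> S)" "0 \<in> range (S \<circ> T)"
    using rangeI[of S 0] rangeI[of T 0] rangeI[of "T \<circ> S" 0] rangeI[of "S \<circ> T" 0]
    by (simp_all add: null_space_def)
  note Times = finite_over_Times_iff[OF h1.vector_space_axioms h2.vector_space_axioms]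
  have fin: "finite_over (sum_scale s1 s2) (range (U \<circ> U)) {0}"
  proof -
    have "range (U \<circ> U) = range (T \<circ> S) \<times> range (S \<circ> T)"
      by (auto simp: U image_iff)
    moreover have "h1.subspace (range (T \<circ> S))" "h2.subspace (range (S \<circ> T))"
      using T.subspace_image[OF S.subspace_range] S.subspace_image[OF T.subspace_range]
      by (simp_all add: image_comp)
    ultimately show ?thesis
      using TS ST zeros Times[of "range (T \<circ> S)" "range (S \<circ> T)" "{0}" "{0}"]
      unfolding zero by (simp only: h1.finite_dim_iff h2.finite_dim_iff singletonI simp_thms)
  qed
  have bV: "bounded_op (sum_scale s1 s2) (sum_scale s1 s2) V"
    unfolding V by (rule bounded_op_add[OF bU bU'])
  have saV: "sum_ip ip1 ip2 (V x) y = sum_ip ip1 ip2 x (V y)" for x y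
    by (simp add: V h.ip_add_left h.ip_add_right adj adj' add.commute)
  have "fredholm_pair s1 s2 S T \<longleftrightarrow> fredholm_op (sum_scale s1 s2) V"
  proof -
    have "null_space U = null_space S \<times> null_space T"
      by (auto simp: U null_space_def zero_prod_def)
    moreover have "range U = range T \<times> range S" by (auto simp: U image_iff)
    ultimately have "fredholm_pair s1 s2 S T \<longleftrightarrow>
        finite_over (sum_scale s1 s2) (null_space U) (range U)"
      using zeros by (simp add: fredholm_pair_iff[OF S T TS ST] Times)
    also have "\<dots> \<longleftrightarrow> fredholm_op (sum_scale s1 s2) V"
      unfolding h.null_space_over_range_iff[OF bU adj fin] h.self_adjoint_fredholm_iff[OF bV saV]
      by (simp add: V)
    finally show ?thesis .
  qed
  moreover have "fredholm_op (sum_scale s1 s2) V \<longleftrightarrow> fredholm_op (sum_scale s1 s2) (V \<circ> V)"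
    using h.square_fredholm_iff[OF bV saV] by simp
  moreover have "fredholm_op (sum_scale s1 s2) (V \<circ> V) \<longleftrightarrow>
      fredholm_op (sum_scale s1 s2) (\<lambda>x. U (U' x) + U' (U x))"
    unfolding V by (rule h.square_fredholm_iff_diagonal_part[OF bU adj fin])
  moreover have "fredholm_op (sum_scale s1 s2) (\<lambda>x. U (U' x) + U' (U x)) \<longleftrightarrow>
      fredholm_op s1 (\<lambda>x. T (T' x) + S' (S x)) \<and> fredholm_op s2 (\<lambda>y. S (S' y) + T' (T y))"
  proof -
    have W: "(\<lambda>x. U (U' x) + U' (U x)) =
      (\<lambda>(x, y). (T (T' x) + S' (S x), S (S' y) + T' (T y)))"
      by (auto simp: U U'_eq)
    have "bounded_op (sum_scale s1 s2) (sum_scale s1 s2) (\<lambda>x. U (U' x) + U' (U x))"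
      by (intro bounded_op_add bounded_op_compose[OF bU bU'] bounded_op_compose[OF bU' bU])
    then show ?thesis
      unfolding W
      by (intro fredholm_op_block_diagonal bounded_op_add bounded_op_compose[OF bT' T]
          bounded_op_compose[OF S bS'] bounded_op_compose[OF bS' S] bounded_op_compose[OF T bT'])
  qed
  ultimately show ?thesis by blast
qed

end
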